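(* Let $b_1,b_2,c_1,c_2,h_1,h_2$ be positive real numbers and consider the system of difference equations $$x_{n+1}=\frac{b_1x_n}{1+x_n+c_1y_n}+h_1,\qquad y_{n+1}=\frac{b_2y_n}{1+y_n+c_2x_n}+h_2,\qquad n=0,1,\ldots,\quad (x_0,y_0)\in[0,\infty)^2 .$$ Then: (i) The system has at least one and at most three equilibria in $[0,\infty)^2$, and the set of equilibria in $[0,\infty)^2$ is linearly ordered by $\preceq_{se}$. (ii) If the system has exactly one equilibrium in $[0,\infty)^2$, then it is globally asymptotically stable. (iii) If the system has three distinct equilibria in $[0,\infty)^2$, say $(\overline{x}_\ell,\overline{y}_\ell)$, $\ell=1,2,3$, with $(\overline{x}_1,\overline{y}_1)\preceq_{se}(\overline{x}_2,\overline{y}_2)\preceq_{se}(\overline{x}_3,\overline{y}_3)$, then $(\overline{x}_1,\overline{y}_1)$ and $(\overline{x}_3,\overline{y}_3)$ are locally asymptotically stable, while $(\overline{x}_2,\overline{y}_2)$ is a saddle point. The global stable manifold of $(\overline{x}_2,\overline{y}_2)$ is the graph of a continuous increasing function of the first variable with endpoints in the boundary of $[0,\infty)^2$, which is a separatrix of the basins of attraction of $(\overline{x}_1,\overline{y}_1)$ and $(\overline{x}_3,\overline{y}_3)$. (iv) If the system has exactly two equilibria in $[0,\infty)^2$, then one is locally asymptotically stable and the other is a nonhyperbolic fixed point. If $(x_1,y_1)$ and $(x_2,y_2)$ are the two equilibria with $(x_1,y_1)\preceq_{se}(x_2,y_2)$, then $Q_2(x_1,y_1)\cap[0,\infty)^2$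 is a subset of the basin of attraction of $(x_1,y_1)$, and $Q_4(x_2,y_2)\cap[0,\infty)^2$ is a subset of the basin of attraction of $(x_2,y_2)$.
   Context: The south-east partial order on $\mathbb{R}^2$: $(x_1,y_1)\preceq_{se}(x_2,y_2)$ if and only if $x_1\le x_2$ and $y_1\ge y_2$. The map of the system is $T:[0,\infty)^2\to[0,\infty)^2$, $T(x,y)=\left(\frac{b_1x}{1+x+c_1y}+h_1,\ \frac{b_2y}{1+y+c_2x}+h_2\right)$; equilibria in $[0,\infty)^2$ are the fixed points of $T$. For $(a,b)\in\mathbb{R}^2$: $Q_2(a,b)=\{(x,y)\in\mathbb{R}^2: x\le a,\ b\le y\}$ and $Q_4(a,b)=\{(x,y)\in\mathbb{R}^2: a\le x,\ y\le b\}$. A fixed point is globally asymptotically stable if it is (Lyapunov) stable and attracts every orbit starting in $[0,\infty)^2$. It is a saddle point if the Jacobian of $T$ there has one eigenvalue of modulus less than $1$ and one of modulus greater than $1$, and nonhyperbolic if the Jacobian has an eigenvalue of modulus $1$. The basin of attraction of a fixed point is the set of points of $[0,\infty)^2$ whose forward $T$-orbit converges to it; the global stable manifold of the saddle point is the set of points of $[0,\infty)^2$ whose forward $T$-orbit converges to the saddle point. A separatrix of two basins is a curve separating them in $[0,\infty)^2$. *)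

theory Defs
  imports "HOL-Analysis.Analysis" "Jordan_Normal_Form.Char_Poly"
begin

definition quadrant :: "(real \<times> real) set" where
  "quadrant = {0..} \<times> {0..}"

definition se_le :: "real \<times> real \<Rightarrow> real \<times> real \<Rightarrow> bool"  (infix "\<preceq>\<^sub>s\<^sub>e" 50) where
  "p \<preceq>\<^sub>s\<^sub>e q \<longleftrightarrow> fst p \<le> fst q \<and> snd q \<le> snd p"

definition Q2 :: "real \<times> real \<Rightarrow> (real \<times> real) set" where
  "Q2 p = {(x, y). x \<le> fst p \<and> snd p \<le> y}"

definition Q4 :: "real \<times> real \<Rightarrow> (real \<times> real) set" where
  "Q4 p = {(x, y). fst p \<le> x \<and> y \<le> snd p}"

definition equilibria :: "(real \<times> real \<Rightarrow> real \<times> real) \<Rightarrow> (real \<times> real) set" where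
  "equilibria T = {p \<in> quadrant. T p = p}"

definition basin :: "(real \<times> real \<Rightarrow> real \<times> real) \<Rightarrow> real \<times> real \<Rightarrow> (real \<times> real) set" where
  "basin T p = {z \<in> quadrant. (\<lambda>n. (T ^^ n) z) \<longlonglongrightarrow> p}"

definition lyapunov_stable :: "(real \<times> real \<Rightarrow> real \<times> real) \<Rightarrow> real \<times> real \<Rightarrow> bool" where
  "lyapunov_stable T p \<longleftrightarrow>
     (\<forall>\<epsilon>>0. \<exists>\<delta>>0. \<forall>z\<in>quadrant. dist z p < \<delta> \<longrightarrow> (\<forall>n. dist ((T ^^ n) z) p < \<epsilon>))"

definition locally_asymptotically_stable ::
  "(real \<times> real \<Rightarrow> real \<times> real) \<Rightarrow> real \<times> real \<Rightarrow> bool" where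
  "locally_asymptotically_stable T p \<longleftrightarrow>
     lyapunov_stable T p \<and> (\<exists>\<delta>>0. \<forall>z\<in>quadrant. dist z p < \<delta> \<longrightarrow> z \<in> basin T p)"

definition globally_asymptotically_stable ::
  "(real \<times> real \<Rightarrow> real \<times> real) \<Rightarrow> real \<times> real \<Rightarrow> bool" where
  "globally_asymptotically_stable T p \<longleftrightarrow> lyapunov_stable T p \<and> quadrant \<subseteq> basin T p"

text \<open>The Jacobian matrix is taken over the complex numbers, so that its eigenvalues are all the
  complex ones. It is only meaningful at points where \<open>T\<close> is differentiable.\<close>

definition jacobian_matrix ::
  "(real \<times> real \<Rightarrow> real \<times> real) \<Rightarrow> real \<times> real \<Rightarrow> complex mat" where
  "jacobian_matrix T p = (let D = frechet_derivative T (at p) in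
     mat_of_rows_list 2
       [[complex_of_real (fst (D (1, 0))), complex_of_real (fst (D (0, 1)))],
        [complex_of_real (snd (D (1, 0))), complex_of_real (snd (D (0, 1)))]])"

definition saddle_point :: "(real \<times> real \<Rightarrow> real \<times> real) \<Rightarrow> real \<times> real \<Rightarrow> bool" where
  "saddle_point T p \<longleftrightarrow>
     (\<exists>\<nu>. eigenvalue (jacobian_matrix T p) \<nu> \<and> cmod \<nu> < 1) \<and>
     (\<exists>\<mu>. eigenvalue (jacobian_matrix T p) \<mu> \<and> cmod \<mu> > 1)"

definition nonhyperbolic :: "(real \<times> real \<Rightarrow> real \<times> real) \<Rightarrow> real \<times> real \<Rightarrow> bool" where
  "nonhyperbolic T p \<longleftrightarrow> (\<exists>\<nu>. eigenvalue (jacobian_matrix T p) \<nu> \<and> cmod \<nu> = 1)"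

definition global_stable_manifold ::
  "(real \<times> real \<Rightarrow> real \<times> real) \<Rightarrow> real \<times> real \<Rightarrow> (real \<times> real) set" where
  "global_stable_manifold T p = {z \<in> quadrant. (\<lambda>n. (T ^^ n) z) \<longlonglongrightarrow> p}"

text \<open>An increasing curve that leaves the quadrant can only do so at infinity on its right-hand
  side; its left endpoint is on one of the coordinate axes. So "endpoints in the boundary" means
  that the domain of the function is a closed half-line \<open>{a..}\<close> and that the point over \<open>a\<close> is a
  boundary point.\<close>

definition increasing_graph_between_boundaries :: "(real \<times> real) set \<Rightarrow> bool" where
  "increasing_graph_between_boundaries C \<longleftrightarrow>
     (\<exists>a f. 0 \<le> a \<and> continuous_on {a..} f \<and> strict_mono_on {a..} f \<and>
        (a, f a) \<in> frontier quadrant \<and> C = (\<lambda>x. (x, f x)) ` {a..} \<and> C \<subseteq> quadrant)"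

text \<open>No connected subset of the quadrant that avoids \<open>C\<close> joins \<open>A\<close> to \<open>B\<close>. That \<open>C\<close> is a
  curve is not part of this definition.\<close>

definition separates_in_quadrant ::
  "(real \<times> real) set \<Rightarrow> (real \<times> real) set \<Rightarrow> (real \<times> real) set \<Rightarrow> bool" where
  "separates_in_quadrant C A B \<longleftrightarrow>
     A \<subseteq> quadrant - C \<and> B \<subseteq> quadrant - C \<and>
     (\<forall>p\<in>A. \<forall>q\<in>B. \<not> connected_component (quadrant - C) p q)"

end

theory Submission
  imports Defs
begin

text \<open>The map \<open>T\<close> is monotone for the south-east order, and it reflects the north-east order since
  its difference quotients form M-matrices. Hence every orbit is eventually monotone in each
  coordinate and converges to an equilibrium. The equilibria are the zeros, in an interval
  \<open>(0, s)\<close>, of a quartic \<open>P\<close> with \<open>P 0 > 0 > P s\<close>. This sign change leaves at most three zeros with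
  multiplicity, and the sign of \<open>P'\<close> at a zero decides stability: if \<open>P' < 0\<close>, points on
  the curve of the first fixed point equation span arbitrarily small invariant order intervals
  around the equilibrium; \<open>P' > 0\<close> and \<open>P' = 0\<close> mean that the Jacobian has an eigenvalue
  greater than or equal to \<open>1\<close>, respectively. Two distinct ordered points cannot both converge to a
  saddle, so its basin is an antichain. It meets each vertical half-line where the open lower set
  of points attracted to the first equilibrium ends, which makes it an increasing graph.\<close>

section \<open>The south-east order and convergence of orbits\<close>

lemma se_le_refl [simp]: "p \<preceq>\<^sub>s\<^sub>e p"
  by (simp add: se_le_def)

lemma se_le_trans: "p \<preceq>\<^sub>s\<^sub>e q \<Longrightarrow> q \<preceq>\<^sub>s\<^sub>e r \<Longrightarrow> p \<preceq>\<^sub>s\<^sub>e r"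
  by (auto simp: se_le_def)

lemma se_le_antisym: "p \<preceq>\<^sub>s\<^sub>e q \<Longrightarrow> q \<preceq>\<^sub>s\<^sub>e p \<Longrightarrow> p = q"
  by (auto simp: se_le_def intro: prod_eqI)

lemma se_le_limit:
  assumes "X \<longlonglongrightarrow> a" "Y \<longlonglongrightarrow> b" "\<And>n. X n \<preceq>\<^sub>s\<^sub>e Y n"
  shows "a \<preceq>\<^sub>s\<^sub>e b"
  unfolding se_le_def
  using LIMSEQ_le[OF tendsto_fst[OF assms(1)] tendsto_fst[OF assms(2)]]
    LIMSEQ_le[OF tendsto_snd[OF assms(2)] tendsto_snd[OF assms(1)]] assms(3)
  by (auto simp: se_le_def)

lemma mem_quadrant_iff: "z \<in> quadrant \<longleftrightarrow> 0 \<le> fst z \<and> 0 \<le> snd z"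
  by (cases z) (simp add: quadrant_def)

lemma closed_quadrant: "closed quadrant"
  by (simp add: quadrant_def closed_Times)

lemma frontier_quadrant_iff: "(x, y) \<in> frontier quadrant \<longleftrightarrow> 0 \<le> x \<and> 0 \<le> y \<and> (x = 0 \<or> y = 0)"
  by (auto simp: frontier_def closed_quadrant quadrant_def interior_Times closure_Times)

lemma convergent_if_eventually_monotone:
  fixes f :: "nat \<Rightarrow> real"
  assumes "Bseq f" and "(\<forall>n\<ge>N. f n \<le> f (Suc n)) \<or> (\<forall>n\<ge>N. f (Suc n) \<le> f n)"
  shows "convergent f"
proof -
  have B: "Bseq (\<lambda>n. f (n + N))"
    using assms(1) by (rule Bseq_ignore_initial_segment)
  from assms(2) show ?thesis
  proof
    assume *: "\<forall>n\<ge>N. f n \<le> f (Suc n)"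
    have "f m \<le> f n" if "N \<le> m" "m \<le> n" for m n
      using that(2) by (induction rule: dec_induct) (use * \<open>N \<le> m\<close> in \<open>auto intro: order_trans\<close>)
    then show ?thesis using Bseq_monoseq_convergent'_inc[OF B] by blast
  next
    assume *: "\<forall>n\<ge>N. f (Suc n) \<le> f n"
    have "f n \<le> f m" if "N \<le> m" "m \<le> n" for m n
      using that(2) by (induction rule: dec_induct) (use * \<open>N \<le> m\<close> in \<open>auto intro: order_trans\<close>)
    then show ?thesis using Bseq_monoseq_convergent'_dec[OF B] by blast
  qed
qed

text \<open>Both coordinates are strict here, so that the order interval between \<open>m\<close>
  and \<open>M\<close> is a neighbourhood of \<open>p\<close> whenever \<open>m \<lless> p\<close>
  and \<open>p \<lless> M\<close>.\<close>

definition se_less :: "real \<times> real \<Rightarrow> real \<times> real \<Rightarrow> bool"  (infix "\<lless>" 50) where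
  "z \<lless> w \<longleftrightarrow> fst z < fst w \<and> snd w < snd z"

section \<open>The map, its bounds and its difference quotients\<close>

locale leslie_gower =
  fixes b1 b2 c1 c2 h1 h2 :: real and T :: "real \<times> real \<Rightarrow> real \<times> real"
  assumes b1: "b1 > 0" and b2: "b2 > 0" and c1: "c1 > 0" and c2: "c2 > 0"
    and h1: "h1 > 0" and h2: "h2 > 0"
    and T_def: "T = (\<lambda>(x, y). (b1 * x / (1 + x + c1 * y) + h1, b2 * y / (1 + y + c2 * x) + h2))"
begin

definition den1 :: "real \<times> real \<Rightarrow> real" where "den1 z = 1 + fst z + c1 * snd z"
definition den2 :: "real \<times> real \<Rightarrow> real" where "den2 z = 1 + snd z + c2 * fst z"

lemma fst_T: "fst (T z) = b1 * fst z / den1 z + h1"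
  by (simp add: T_def den1_def case_prod_beta)

lemma snd_T: "snd (T z) = b2 * snd z / den2 z + h2"
  by (simp add: T_def den2_def case_prod_beta)

lemma den1_pos: "z \<in> quadrant \<Longrightarrow> den1 z > 0"
  using c1 by (simp add: den1_def mem_quadrant_iff add_pos_nonneg)

lemma den2_pos: "z \<in> quadrant \<Longrightarrow> den2 z > 0"
  using c2 by (simp add: den2_def mem_quadrant_iff add_pos_nonneg)

text \<open>Each denominator dominates the coordinate in its numerator, so each fraction lies
  between 0 and its coefficient. The resulting rectangle bounds all orbits after one step and
  supplies comparison points outside it.\<close>

lemma T_bounds:
  assumes "z \<in> quadrant"
  shows "h1 \<le> fst (T z)" "fst (T z) \<le> h1 + b1" "h2 \<le> snd (T z)" "snd (T z) \<le> h2 + b2"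
proof -
  have "fst z \<le> den1 z" "snd z \<le> den2 z"
    using assms c1 c2 by (auto simp: den1_def den2_def mem_quadrant_iff)
  moreover have "fst z \<ge> 0" "snd z \<ge> 0" using assms by (auto simp: mem_quadrant_iff)
  ultimately show "h1 \<le> fst (T z)" "fst (T z) \<le> h1 + b1" "h2 \<le> snd (T z)" "snd (T z) \<le> h2 + b2"
    using den1_pos[OF assms] den2_pos[OF assms] b1 b2
    by (auto simp: fst_T snd_T divide_simps distrib_right)
qed

lemma T_quadrant: "z \<in> quadrant \<Longrightarrow> T z \<in> quadrant"
  using T_bounds[of z] h1 h2 unfolding mem_quadrant_iff by linarith

lemma orbit_quadrant: "z \<in> quadrant \<Longrightarrow> (T ^^ n) z \<in> quadrant"
  by (induction n) (auto intro: T_quadrant)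

lemma continuous_on_T: "continuous_on quadrant T"
proof -
  have "continuous_on quadrant (\<lambda>z. (b1 * fst z / den1 z + h1, b2 * snd z / den2 z + h2))"
    using den1_pos den2_pos unfolding den1_def den2_def
    by (intro continuous_intros) (auto simp: less_le)
  then show ?thesis
    by (simp add: T_def den1_def den2_def case_prod_beta)
qed

lemma continuous_on_orbit: "continuous_on quadrant (T ^^ n)"
proof (induction n)
  case (Suc n)
  then show ?case
    unfolding funpow.simps using orbit_quadrant
    by (intro continuous_on_compose continuous_on_subset[OF continuous_on_T]) auto
qed (simp add: id_def)

text \<open>Since \<open>T\<close> is linear fractional in each component, \<open>T w - T z\<close> is exactly the image of
  \<open>w - z\<close> under the matrix with rows \<open>(q11, - q12)\<close> and \<open>(- q21, q22)\<close>. On the diagonal this is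
  the Jacobian matrix.\<close>

definition q11 :: "real \<times> real \<Rightarrow> real \<times> real \<Rightarrow> real" where
  "q11 z w = b1 * (1 + c1 * snd z) / (den1 z * den1 w)"
definition q12 :: "real \<times> real \<Rightarrow> real \<times> real \<Rightarrow> real" where
  "q12 z w = b1 * c1 * fst z / (den1 z * den1 w)"
definition q21 :: "real \<times> real \<Rightarrow> real \<times> real \<Rightarrow> real" where
  "q21 z w = b2 * c2 * snd z / (den2 z * den2 w)"
definition q22 :: "real \<times> real \<Rightarrow> real \<times> real \<Rightarrow> real" where
  "q22 z w = b2 * (1 + c2 * fst z) / (den2 z * den2 w)"

lemma fst_T_diff:
  assumes "z \<in> quadrant" "w \<in> quadrant"
  shows "fst (T w) - fst (T z) = q11 z w * (fst w - fst z) + q12 z w * (snd z - snd w)"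
proof -
  have "den1 z > 0" "den1 w > 0" using assms den1_pos by auto
  then have "fst (T w) - fst (T z) = b1 * (fst w * den1 z - fst z * den1 w) / (den1 z * den1 w)"
    by (simp add: fst_T field_simps)
  also have "fst w * den1 z - fst z * den1 w
      = (1 + c1 * snd z) * (fst w - fst z) + c1 * fst z * (snd z - snd w)"
    by (simp add: den1_def algebra_simps)
  finally show ?thesis by (simp only: q11_def q12_def add_divide_distrib[symmetric] times_divide_eq_left)
      (simp add: algebra_simps)
qed

lemma snd_T_diff:
  assumes "z \<in> quadrant" "w \<in> quadrant"
  shows "snd (T z) - snd (T w) = q21 z w * (fst w - fst z) + q22 z w * (snd z - snd w)"
proof -
  have "den2 z > 0" "den2 w > 0" using assms den2_pos by auto
  then have "snd (T z) - snd (T w) = b2 * (snd z * den2 w - snd w * den2 z) / (den2 z * den2 w)"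
    by (simp add: snd_T field_simps)
  also have "snd z * den2 w - snd w * den2 z
      = c2 * snd z * (fst w - fst z) + (1 + c2 * fst z) * (snd z - snd w)"
    by (simp add: den2_def algebra_simps)
  finally show ?thesis by (simp only: q21_def q22_def add_divide_distrib[symmetric] times_divide_eq_left)
      (simp add: algebra_simps)
qed

lemma q_signs:
  assumes "z \<in> quadrant" "w \<in> quadrant"
  shows "q11 z w > 0" "q12 z w \<ge> 0" "q21 z w \<ge> 0" "q22 z w > 0"
  using assms b1 b2 c1 c2 den1_pos[of z] den1_pos[of w] den2_pos[of z] den2_pos[of w]
  by (auto simp: q11_def q12_def q21_def q22_def mem_quadrant_iff
      intro!: divide_pos_pos divide_nonneg_pos mult_pos_pos add_pos_nonneg)

text \<open>Expanding \<open>(1 + c1 * snd z) * (1 + c2 * fst z)\<close> produces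
  \<open>c1 * fst z * (c2 * snd z)\<close> plus terms that are at least 1 in sum. The positive
  determinant is what makes \<open>T\<close> injective and lets it reflect the north-east
  order.\<close>

lemma q_det:
  assumes "z \<in> quadrant" "w \<in> quadrant"
  shows "q12 z w * q21 z w < q11 z w * q22 z w"
proof -
  have D: "den1 z * den1 w * (den2 z * den2 w) > 0"
    using assms den1_pos den2_pos by auto
  have "b1 * b2 * (c1 * fst z * (c2 * snd z)) < b1 * b2 * ((1 + c1 * snd z) * (1 + c2 * fst z))"
    using assms b1 b2 c1 c2
    by (intro mult_strict_left_mono) (auto simp: mem_quadrant_iff algebra_simps add_pos_nonneg)
  then show ?thesis
    using divide_strict_right_mono[OF _ D] by (fastforce simp: q11_def q12_def q21_def q22_def mult_ac)
qed

section \<open>Monotonicity of the map and reflection of the north-east order\<close>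

lemma T_mono:
  assumes "z \<in> quadrant" "w \<in> quadrant" "z \<preceq>\<^sub>s\<^sub>e w"
  shows "T z \<preceq>\<^sub>s\<^sub>e T w"
proof -
  have "fst (T w) - fst (T z) \<ge> 0" "snd (T z) - snd (T w) \<ge> 0"
    using assms q_signs[OF assms(1,2)]
    unfolding fst_T_diff[OF assms(1,2)] snd_T_diff[OF assms(1,2)]
    by (auto simp: se_le_def)
  then show ?thesis by (simp add: se_le_def)
qed

lemma orbit_mono:
  assumes "z \<in> quadrant" "w \<in> quadrant" "z \<preceq>\<^sub>s\<^sub>e w"
  shows "(T ^^ n) z \<preceq>\<^sub>s\<^sub>e (T ^^ n) w"
  using assms by (induction n) (auto intro: T_mono orbit_quadrant)

lemma T_strict_mono:
  assumes "z \<in> quadrant" "w \<in> quadrant" "z \<lless> w"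
  shows "T z \<lless> T w"
proof -
  have "fst (T w) - fst (T z) > 0" "snd (T z) - snd (T w) > 0"
    using assms q_signs[OF assms(1,2)]
    unfolding fst_T_diff[OF assms(1,2)] snd_T_diff[OF assms(1,2)]
    by (auto simp: se_less_def intro: add_pos_nonneg add_nonneg_pos)
  then show ?thesis by (simp add: se_less_def)
qed

lemma orbit_strict_mono:
  assumes "z \<in> quadrant" "w \<in> quadrant" "z \<lless> w"
  shows "(T ^^ n) z \<lless> (T ^^ n) w"
  using assms by (induction n) (auto intro: T_strict_mono orbit_quadrant)

text \<open>The matrix of the \<open>q\<close>'s is an M-matrix, so its inverse is nonnegative.\<close>

lemma T_ne_reflect:
  assumes "z \<in> quadrant" "w \<in> quadrant"
    and "fst (T z) \<le> fst (T w)" "snd (T z) \<le> snd (T w)"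
  shows "fst z \<le> fst w" "snd z \<le> snd w"
proof -
  define dx dy where "dx = fst w - fst z" and "dy = snd w - snd z"
  define p q r t where "p = q11 z w" and "q = q12 z w" and "r = q21 z w" and "t = q22 z w"
  have pos: "p > 0" "q \<ge> 0" "r \<ge> 0" "t > 0" and det: "p * t - q * r > 0"
    using q_signs[OF assms(1,2)] q_det[OF assms(1,2)] by (auto simp: p_def q_def r_def t_def)
  have e1: "p * dx - q * dy \<ge> 0"
    using fst_T_diff[OF assms(1,2)] assms(3) by (simp add: p_def q_def dx_def dy_def algebra_simps)
  have e2: "t * dy - r * dx \<ge> 0"
    using snd_T_diff[OF assms(1,2)] assms(4) by (simp add: r_def t_def dx_def dy_def algebra_simps)
  \<comment> \<open>The rows of the adjugate matrix are applied to the two inequalities: this one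
    eliminates \<open>dy\<close>, the later one \<open>dx\<close>.\<close>
  have "(p * t - q * r) * dx = t * (p * dx - q * dy) + q * (t * dy - r * dx)"
    by (simp add: algebra_simps)
  also have "\<dots> \<ge> 0" using e1 e2 pos by (intro add_nonneg_nonneg mult_nonneg_nonneg) auto
  finally show "fst z \<le> fst w" using det by (simp add: zero_le_mult_iff dx_def)
  have "(p * t - q * r) * dy = r * (p * dx - q * dy) + p * (t * dy - r * dx)"
    by (simp add: algebra_simps)
  also have "\<dots> \<ge> 0" using e1 e2 pos by (intro add_nonneg_nonneg mult_nonneg_nonneg) auto
  finally show "snd z \<le> snd w" using det by (simp add: zero_le_mult_iff dy_def)
qed

lemma T_inj: "z \<in> quadrant \<Longrightarrow> w \<in> quadrant \<Longrightarrow> T z = T w \<Longrightarrow> z = w"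
  by (rule prod_eqI; rule antisym; rule T_ne_reflect; simp)

lemma orbit_inj: "z \<in> quadrant \<Longrightarrow> w \<in> quadrant \<Longrightarrow> (T ^^ n) z = (T ^^ n) w \<Longrightarrow> z = w"
proof (induction n)
  case (Suc n)
  then show ?case using T_inj[OF orbit_quadrant orbit_quadrant, of z w n n] by simp
qed simp

section \<open>Convergence of every orbit\<close>

lemma orbit_limit_in_equilibria:
  assumes "z \<in> quadrant" "(\<lambda>n. (T ^^ n) z) \<longlonglongrightarrow> e"
  shows "e \<in> equilibria T"
proof -
  have e: "e \<in> quadrant"
    using closed_sequentially[OF closed_quadrant orbit_quadrant[OF assms(1)] assms(2)] .
  have "(\<lambda>n. T ((T ^^ n) z)) \<longlonglongrightarrow> T e"
    using orbit_quadrant[OF assms(1)]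
    by (intro continuous_on_tendsto_compose[OF continuous_on_T assms(2) e] always_eventually allI)
  moreover have "(\<lambda>n. T ((T ^^ n) z)) \<longlonglongrightarrow> e"
    using LIMSEQ_Suc[OF assms(2)] by simp
  ultimately show ?thesis
    using e LIMSEQ_unique unfolding equilibria_def by blast
qed

text \<open>If two consecutive orbit points are comparable in the south-east order, the orbit is monotone
  from then on. Otherwise all consecutive points are comparable in the north-east order, and since
  \<open>T\<close> reflects that order the direction can change at most once.\<close>

lemma orbit_eventually_monotone:
  assumes z: "z \<in> quadrant"
  shows "\<exists>N. ((\<forall>n\<ge>N. fst ((T ^^ n) z) \<le> fst ((T ^^ Suc n) z)) \<or>
              (\<forall>n\<ge>N. fst ((T ^^ Suc n) z) \<le> fst ((T ^^ n) z))) \<and>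
             ((\<forall>n\<ge>N. snd ((T ^^ n) z) \<le> snd ((T ^^ Suc n) z)) \<or>
              (\<forall>n\<ge>N. snd ((T ^^ Suc n) z) \<le> snd ((T ^^ n) z)))"
proof -
  let ?o = "\<lambda>n. (T ^^ n) z"
  have Q: "?o n \<in> quadrant" for n using z by (rule orbit_quadrant)
  consider (up) N where "?o N \<preceq>\<^sub>s\<^sub>e ?o (Suc N)" | (down) N where "?o (Suc N) \<preceq>\<^sub>s\<^sub>e ?o N"
    | (ne) "\<And>n. \<not> ?o n \<preceq>\<^sub>s\<^sub>e ?o (Suc n) \<and> \<not> ?o (Suc n) \<preceq>\<^sub>s\<^sub>e ?o n"
    by blast
  then show ?thesis
  proof cases
    case up
    have "?o n \<preceq>\<^sub>s\<^sub>e ?o (Suc n)" if "n \<ge> N" for n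
      using that by (induction rule: dec_induct) (use up T_mono[OF Q T_quadrant[OF Q]] in auto)
    then show ?thesis unfolding se_le_def by blast
  next
    case down
    have "?o (Suc n) \<preceq>\<^sub>s\<^sub>e ?o n" if "n \<ge> N" for n
      using that by (induction rule: dec_induct) (use down T_mono[OF T_quadrant[OF Q] Q] in auto)
    then show ?thesis unfolding se_le_def by blast
  next
    case ne
    define U where "U n \<longleftrightarrow> fst (?o n) \<le> fst (?o (Suc n)) \<and> snd (?o n) \<le> snd (?o (Suc n))" for n
    have U_prev: "U n" if "U (Suc n)" for n
      using that T_ne_reflect[OF Q Q, of n "Suc n"] by (simp add: U_def)
    \<comment> \<open>Without south-east comparability both coordinates move in the same direction,
      so a step that is not upward is downward.\<close>
    have D: "fst (?o (Suc n)) \<le> fst (?o n) \<and> snd (?o (Suc n)) \<le> snd (?o n)" if "\<not> U n" for n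
      using that ne[of n] unfolding U_def se_le_def by linarith
    show ?thesis
    proof (cases "\<forall>n. U n")
      case True
      then show ?thesis unfolding U_def by blast
    next
      case False
      then obtain N where N: "\<not> U N" by blast
      have "\<not> U n" if "n \<ge> N" for n
        using that by (induction rule: dec_induct) (use N U_prev in auto)
      then show ?thesis using D by blast
    qed
  qed
qed

text \<open>Both coordinate sequences are bounded and eventually monotone, hence convergent, and by
  continuity the limit is a fixed point.\<close>

lemma orbit_converges:
  assumes z: "z \<in> quadrant"
  obtains e where "e \<in> equilibria T" "z \<in> basin T e"
proof -
  obtain N where N: "(\<forall>n\<ge>N. fst ((T ^^ n) z) \<le> fst ((T ^^ Suc n) z)) \<or>
              (\<forall>n\<ge>N. fst ((T ^^ Suc n) z) \<le> fst ((T ^^ n) z))"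
             "(\<forall>n\<ge>N. snd ((T ^^ n) z) \<le> snd ((T ^^ Suc n) z)) \<or>
              (\<forall>n\<ge>N. snd ((T ^^ Suc n) z) \<le> snd ((T ^^ n) z))"
    using orbit_eventually_monotone[OF z] by blast
  have bd: "\<bar>fst ((T ^^ n) z)\<bar> \<le> fst z + h1 + b1 \<and> \<bar>snd ((T ^^ n) z)\<bar> \<le> snd z + h2 + b2" for n
  proof (cases n)
    case 0
    then show ?thesis using z h1 h2 b1 b2 by (simp add: mem_quadrant_iff)
  next
    case (Suc m)
    then show ?thesis
      using T_bounds[OF orbit_quadrant[OF z, of m]] orbit_quadrant[OF z, of n] z
      by (auto simp: mem_quadrant_iff)
  qed
  have "Bseq (\<lambda>n. fst ((T ^^ n) z))" "Bseq (\<lambda>n. snd ((T ^^ n) z))"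
    using bd by (auto intro: BseqI'[where K = "fst z + h1 + b1"] BseqI'[where K = "snd z + h2 + b2"])
  then have "convergent (\<lambda>n. fst ((T ^^ n) z))" "convergent (\<lambda>n. snd ((T ^^ n) z))"
    using convergent_if_eventually_monotone[OF _ N(1)] convergent_if_eventually_monotone[OF _ N(2)]
    by auto
  then obtain x y where "(\<lambda>n. fst ((T ^^ n) z)) \<longlonglongrightarrow> x" "(\<lambda>n. snd ((T ^^ n) z)) \<longlonglongrightarrow> y"
    unfolding convergent_def by blast
  from tendsto_Pair[OF this] have "(\<lambda>n. (T ^^ n) z) \<longlonglongrightarrow> (x, y)"
    by simp
  then show thesis using that orbit_limit_in_equilibria[OF z] z by (auto simp: basin_def)
qed

section \<open>Basins of attraction and stability in order intervals\<close>

lemma basin_unique: "z \<in> basin T p \<Longrightarrow> z \<in> basin T q \<Longrightarrow> p = q"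
  using LIMSEQ_unique by (auto simp: basin_def)

lemma equilibrium_orbit: "p \<in> equilibria T \<Longrightarrow> (T ^^ n) p = p"
  by (induction n) (auto simp: equilibria_def)

lemma equilibrium_in_basin: "p \<in> equilibria T \<Longrightarrow> p \<in> basin T p"
  by (auto simp: basin_def equilibrium_orbit) (simp add: equilibria_def)

lemma basin_mono:
  assumes "z \<in> basin T p" "w \<in> basin T q" "z \<preceq>\<^sub>s\<^sub>e w"
  shows "p \<preceq>\<^sub>s\<^sub>e q"
  using assms(1,2) se_le_limit[of "\<lambda>n. (T ^^ n) z" p "\<lambda>n. (T ^^ n) w" q] orbit_mono[OF _ _ assms(3)]
  by (simp add: basin_def)

lemma equilibrium_pos:
  assumes "p \<in> equilibria T"
  shows "fst p > 0" "snd p > 0" "p \<in> quadrant" "T p = p"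
  using T_bounds[of p] h1 h2 assms by (auto simp: equilibria_def)

text \<open>The iterates of \<open>m\<close> increase and those of \<open>M\<close> decrease, so
  each order interval between \<open>(T ^^ n) m\<close> and \<open>(T ^^ n) M\<close> is invariant.
  Orbits in the first one converge to an equilibrium in it, which can only be \<open>p\<close>. In
  particular the two corner orbits converge to \<open>p\<close>, and the intervals shrink to
  \<open>p\<close>; this gives Lyapunov stability.\<close>

lemma interval_stable:
  assumes m: "m \<in> quadrant" "m \<preceq>\<^sub>s\<^sub>e T m" "m \<lless> p"
    and M: "M \<in> quadrant" "T M \<preceq>\<^sub>s\<^sub>e M" "p \<lless> M"
    and p: "p \<in> equilibria T"
    and unique: "\<And>e. e \<in> equilibria T \<Longrightarrow> m \<preceq>\<^sub>s\<^sub>e e \<Longrightarrow> e \<preceq>\<^sub>s\<^sub>e M \<Longrightarrow> e = p"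
  shows "locally_asymptotically_stable T p"
proof -
  have pQ: "p \<in> quadrant" "T p = p" using equilibrium_pos p by auto
  have inv_m: "(T ^^ n) m \<preceq>\<^sub>s\<^sub>e (T ^^ (n + k)) m" for n k
  proof (induction k)
    case (Suc k)
    have "(T ^^ (n + k)) m \<preceq>\<^sub>s\<^sub>e (T ^^ (n + k)) (T m)"
      by (intro orbit_mono m T_quadrant)
    from se_le_trans[OF Suc this] show ?case by (simp add: funpow_swap1)
  qed simp
  have inv_M: "(T ^^ (n + k)) M \<preceq>\<^sub>s\<^sub>e (T ^^ n) M" for n k
  proof (induction k)
    case (Suc k)
    have "(T ^^ (n + k)) (T M) \<preceq>\<^sub>s\<^sub>e (T ^^ (n + k)) M"
      by (intro orbit_mono M T_quadrant)
    from se_le_trans[OF this Suc] show ?case by (simp add: funpow_swap1)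
  qed simp
  have attr: "z \<in> basin T p" if z: "z \<in> quadrant" "m \<preceq>\<^sub>s\<^sub>e z" "z \<preceq>\<^sub>s\<^sub>e M" for z
  proof -
    obtain e where e: "e \<in> equilibria T" "z \<in> basin T e" using orbit_converges z(1) .
    have "m \<preceq>\<^sub>s\<^sub>e (T ^^ n) z" "(T ^^ n) z \<preceq>\<^sub>s\<^sub>e M" for n
      using se_le_trans[OF inv_m[of 0 n, simplified] orbit_mono[OF m(1) z(1,2)]]
        se_le_trans[OF orbit_mono[OF z(1) M(1) z(3)] inv_M[of 0 n, simplified]] by auto
    moreover have "(\<lambda>n. (T ^^ n) z) \<longlonglongrightarrow> e" using e(2) by (simp add: basin_def)
    ultimately have "m \<preceq>\<^sub>s\<^sub>e e" "e \<preceq>\<^sub>s\<^sub>e M"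
      using se_le_limit[of "\<lambda>n. m" m "\<lambda>n. (T ^^ n) z" e] se_le_limit[of "\<lambda>n. (T ^^ n) z" e "\<lambda>n. M" M]
      by simp_all
    then show ?thesis using unique e by blast
  qed
  have nbhd: "\<exists>\<delta>>0. \<forall>z. dist z p < \<delta> \<longrightarrow> (T ^^ n) m \<preceq>\<^sub>s\<^sub>e z \<and> z \<preceq>\<^sub>s\<^sub>e (T ^^ n) M" for n
  proof -
    define a b where "a = (T ^^ n) m" and "b = (T ^^ n) M"
    \<comment> \<open>Strict monotonicity of the iterates keeps \<open>p\<close> strictly between
      the two corners, which leaves room for a ball around \<open>p\<close>.\<close>
    have lt: "a \<lless> p" "p \<lless> b"
      using orbit_strict_mono[of m p n] orbit_strict_mono[of p M n] m M pQ equilibrium_orbit[OF p]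
      by (auto simp: a_def b_def)
    define \<delta> where "\<delta> = Min {fst p - fst a, snd a - snd p, fst b - fst p, snd p - snd b}"
    have "\<delta> > 0" using lt by (auto simp: \<delta>_def se_less_def)
    moreover have "a \<preceq>\<^sub>s\<^sub>e z \<and> z \<preceq>\<^sub>s\<^sub>e b" if "dist z p < \<delta>" for z
    proof -
      have "\<bar>fst z - fst p\<bar> < \<delta>" "\<bar>snd z - snd p\<bar> < \<delta>"
        using that dist_fst_le[of z p] dist_snd_le[of z p] by (auto simp: dist_real_def)
      then show ?thesis unfolding \<delta>_def se_le_def by auto
    qed
    ultimately show ?thesis unfolding a_def b_def by blast
  qed
  have mM: "m \<preceq>\<^sub>s\<^sub>e M" using m M by (auto simp: se_less_def se_le_def)
  have "lyapunov_stable T p"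
    unfolding lyapunov_stable_def
  proof (intro allI impI)
    fix \<epsilon> :: real assume \<epsilon>: "\<epsilon> > 0"
    have "m \<in> basin T p" "M \<in> basin T p" using attr m M mM by auto
    then have "(\<lambda>n. (T ^^ n) m) \<longlonglongrightarrow> p" "(\<lambda>n. (T ^^ n) M) \<longlonglongrightarrow> p"
      by (auto simp: basin_def)
    \<comment> \<open>Half of \<epsilon> is enough for each coordinate, since the distance is at
      most the sum of the two coordinate distances.\<close>
    then have "\<forall>\<^sub>F n in sequentially. dist ((T ^^ n) m) p < \<epsilon> / 2 \<and> dist ((T ^^ n) M) p < \<epsilon> / 2"
      using \<epsilon> half_gt_zero by (intro eventually_conj tendstoD)
    then obtain n where n: "dist ((T ^^ n) m) p < \<epsilon> / 2" "dist ((T ^^ n) M) p < \<epsilon> / 2"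
      using eventually_happens'[OF sequentially_bot] by blast
    obtain \<delta> where \<delta>: "\<delta> > 0" "\<And>z. dist z p < \<delta> \<Longrightarrow> (T ^^ n) m \<preceq>\<^sub>s\<^sub>e z \<and> z \<preceq>\<^sub>s\<^sub>e (T ^^ n) M"
      using nbhd by blast
    have iter: "(T ^^ k) ((T ^^ n) v) = (T ^^ (n + k)) v" for v k
      by (metis add.commute comp_apply funpow_add)
    have "dist ((T ^^ k) z) p < \<epsilon>" if z: "z \<in> quadrant" "dist z p < \<delta>" for z k
    proof -
      have "(T ^^ n) m \<preceq>\<^sub>s\<^sub>e (T ^^ k) z" "(T ^^ k) z \<preceq>\<^sub>s\<^sub>e (T ^^ n) M"
        using se_le_trans[OF inv_m[of n k]] se_le_trans[OF _ inv_M[of n k]] \<delta>(2)[OF z(2)]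
          orbit_mono[OF orbit_quadrant[OF m(1)] z(1), of n k]
          orbit_mono[OF z(1) orbit_quadrant[OF M(1)], of n k]
        unfolding iter by blast+
      then have "\<bar>fst ((T ^^ k) z) - fst p\<bar> < \<epsilon> / 2" "\<bar>snd ((T ^^ k) z) - snd p\<bar> < \<epsilon> / 2"
        using dist_fst_le[of "(T ^^ n) m" p] dist_snd_le[of "(T ^^ n) m" p]
          dist_fst_le[of "(T ^^ n) M" p] dist_snd_le[of "(T ^^ n) M" p] n
        unfolding se_le_def dist_real_def abs_less_iff by linarith+
      then show ?thesis
        using sqrt_sum_squares_le_sum_abs[of "fst ((T ^^ k) z) - fst p" "snd ((T ^^ k) z) - snd p"]
        by (simp add: dist_prod_def dist_real_def)
    qed
    then show "\<exists>\<delta>>0. \<forall>z\<in>quadrant. dist z p < \<delta> \<longrightarrow> (\<forall>n. dist ((T ^^ n) z) p < \<epsilon>)"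
      using \<delta>(1) by blast
  qed
  moreover have "\<exists>\<delta>>0. \<forall>z\<in>quadrant. dist z p < \<delta> \<longrightarrow> z \<in> basin T p"
  proof -
    obtain \<delta> where "\<delta> > 0" "\<And>z. dist z p < \<delta> \<Longrightarrow> m \<preceq>\<^sub>s\<^sub>e z \<and> z \<preceq>\<^sub>s\<^sub>e M"
      using nbhd[of 0] by auto
    then show ?thesis using attr by blast
  qed
  ultimately show ?thesis by (simp add: locally_asymptotically_stable_def)
qed

lemma unique_equilibrium_globally_stable:
  assumes "equilibria T = {p}"
  shows "globally_asymptotically_stable T p"
proof -
  have p: "p \<in> equilibria T" using assms by simp
  note pp = equilibrium_pos[OF p]
  have "locally_asymptotically_stable T p"
  proof (rule interval_stable)
    \<comment> \<open>The two corners lie beyond the rectangle that contains the image of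
      \<open>T\<close>, so \<open>T\<close> moves them towards each other; the summand 1 keeps
      \<open>p\<close> strictly inside.\<close>
    show "(0, h2 + b2 + 1) \<preceq>\<^sub>s\<^sub>e T (0, h2 + b2 + 1)" "T (h1 + b1 + 1, 0) \<preceq>\<^sub>s\<^sub>e (h1 + b1 + 1, 0)"
      using T_bounds[of "(0, h2 + b2 + 1)"] T_bounds[of "(h1 + b1 + 1, 0)"] h1 h2 b1 b2
      by (auto simp: se_le_def mem_quadrant_iff)
    show "(0, h2 + b2 + 1) \<lless> p" "p \<lless> (h1 + b1 + 1, 0)"
      using pp T_bounds[OF pp(3)] by (auto simp: se_less_def)
  qed (use h1 h2 b1 b2 assms in \<open>auto simp: mem_quadrant_iff\<close>)
  moreover have "quadrant \<subseteq> basin T p"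
    using assms by (auto elim: orbit_converges)
  ultimately show ?thesis
    by (simp add: locally_asymptotically_stable_def globally_asymptotically_stable_def)
qed

end

section \<open>Equilibria as zeros of a quartic\<close>

text \<open>At 0 and at \<open>s\<close> the product \<open>(x - a) * (x - b)\<close> is positive,
  so the cofactor inherits the sign change and has a root \<open>t\<close> in between. What then
  remains is affine and negative at both ends, hence on the whole interval. The root
  \<open>t\<close> may coincide with \<open>a\<close> or \<open>b\<close>, which is the case of a
  double root.\<close>

lemma poly_factor_two_roots:
  fixes p :: "real poly"
  assumes "degree p \<le> 4" "poly p 0 > 0" "poly p s < 0"
    and "0 < a" "a < s" "poly p a = 0" "0 < b" "b < s" "poly p b = 0" "a \<noteq> b"
  shows "\<exists>t l m. 0 < t \<and> t < s \<and> (\<forall>x. poly p x = (x - a) * (x - b) * (x - t) * (l + m * x)) \<and>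
    (\<forall>x. 0 \<le> x \<and> x \<le> s \<longrightarrow> l + m * x < 0)"
proof -
  have p0: "p \<noteq> 0" using assms(2) by auto
  obtain q where q: "p = [:- a, 1:] * q" using assms(6) unfolding poly_eq_0_iff_dvd by (rule dvdE)
  then have "poly q b = 0" using assms(9,10) by auto
  then obtain r where r: "q = [:- b, 1:] * r" unfolding poly_eq_0_iff_dvd by (rule dvdE)
  have P: "poly p x = (x - a) * (x - b) * poly r x" for x by (simp add: q r algebra_simps)
  have r0: "poly r 0 > 0"
    using assms(2) mult_pos_pos[OF assms(4,7)] P[of 0] by (simp add: zero_less_mult_iff)
  have rs: "poly r s < 0"
    using assms(3,5,8) P[of s] by (auto simp: mult_less_0_iff zero_less_mult_iff)
  obtain t where t: "0 < t" "t < s" "poly r t = 0"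
    using poly_IVT_neg[of 0 s r] r0 rs assms(4,5) by auto
  from t(3) obtain g where g: "r = [:- t, 1:] * g" unfolding poly_eq_0_iff_dvd by (rule dvdE)
  have "g \<noteq> 0" using r0 g by auto
  then have "degree p = 3 + degree g"
    by (simp add: q r g degree_mult_eq del: mult_pCons_left)
  then have "degree g \<le> 1" using assms(1) by simp
  then have "g = [:coeff g 0, coeff g 1:]"
    by (intro poly_eqI) (use le_degree[of g] in \<open>fastforce simp: coeff_pCons split: nat.split\<close>)
  then obtain l m where lm: "g = [:l, m:]" by blast
  have P': "poly p x = (x - a) * (x - b) * (x - t) * (l + m * x)" for x
    by (simp add: q r g lm algebra_simps)
  have "poly r x = (x - t) * (l + m * x)" for x
    by (simp add: g lm algebra_simps)
  then have "l < 0" "l + m * s < 0"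
    using r0 rs t by (auto simp: zero_less_mult_iff mult_less_0_iff)
  have "l + m * x < 0" if "0 \<le> x" "x \<le> s" for x
  proof (cases "m \<le> 0")
    case True
    then show ?thesis using \<open>l < 0\<close> mult_nonpos_nonneg[of m x] that by simp
  next
    case False
    then show ?thesis using \<open>l + m * s < 0\<close> mult_left_mono[of x s m] that by linarith
  qed
  then show ?thesis using t(1,2) P' by blast
qed

context leslie_gower
begin

text \<open>Relative to the origin \<open>(h1, h2)\<close>, the first fixed point equation reads
  \<open>W u = c1 * u * v\<close> and the second one \<open>G u v = 0\<close>. The quartic \<open>P\<close> is \<open>- (c1 u)\<^sup>2 G\<close> along the
  curve given by the first equation, and \<open>s\<close> is where this curve leaves \<open>v > 0\<close>.\<close>

definition A :: real where "A = b1 - 1 - h1 - c1 * h2"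
definition B :: real where "B = b1 * h1"
definition A' :: real where "A' = b2 - 1 - h2 - c2 * h1"
definition B' :: real where "B' = b2 * h2"
definition W :: "real \<Rightarrow> real" where "W u = A * u - u\<^sup>2 + B"
definition G :: "real \<Rightarrow> real \<Rightarrow> real" where "G u v = A' * v - v\<^sup>2 + B' - c2 * u * v"
definition P :: "real \<Rightarrow> real" where
  "P u = (W u)\<^sup>2 + c1 * c2 * u\<^sup>2 * W u - A' * c1 * u * W u - B' * c1\<^sup>2 * u\<^sup>2"
definition s :: real where "s = (A + sqrt (A\<^sup>2 + 4 * B)) / 2"
definition v :: "real \<Rightarrow> real" where "v u = W u / (c1 * u)"
text \<open>Parametrizes the curve of the first fixed point equation in the original
  coordinates.\<close>

definition E :: "real \<Rightarrow> real \<times> real" where "E u = (h1 + u, h2 + v u)"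

lemma B_pos: "B > 0" "B' > 0"
  using b1 b2 h1 h2 by (auto simp: B_def B'_def)

lemma s_pos: "s > 0"
proof -
  have "sqrt (A\<^sup>2) < sqrt (A\<^sup>2 + 4 * B)" using B_pos by (intro real_sqrt_less_mono) simp
  then show ?thesis by (simp add: s_def)
qed

lemma W_s: "W s = 0"
proof -
  have "(sqrt (A\<^sup>2 + 4 * B))\<^sup>2 = A\<^sup>2 + 4 * B" using B_pos by (intro real_sqrt_pow2) simp
  then show ?thesis by (simp add: W_def s_def power2_eq_square field_simps)
qed

lemma W_pos_iff:
  assumes "u > 0"
  shows "W u > 0 \<longleftrightarrow> u < s"
proof -
  \<comment> \<open>The quadratic \<open>W\<close> has the roots \<open>s\<close> and
    \<open>- B / s\<close>; the identity is its factorization, multiplied by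
    \<open>s\<close>.\<close>
  have "s * W u - u * W s = (s - u) * (s * u + B)"
    by (simp add: W_def power2_eq_square algebra_simps)
  then have *: "s * W u = (s - u) * (s * u + B)" by (simp add: W_s)
  have "s * u + B > 0" using assms s_pos B_pos by (simp add: add_pos_pos)
  then have "0 < s * W u \<longleftrightarrow> u < s" unfolding * by (simp add: zero_less_mult_iff)
  then show ?thesis using s_pos by (simp add: zero_less_mult_iff)
qed

lemma P_0: "P 0 > 0"
  using B_pos by (simp add: P_def W_def)

lemma P_s: "P s < 0"
  using B_pos c1 s_pos by (simp add: P_def W_s)

text \<open>The leading coefficient \<open>1 - c1 * c2\<close> may vanish, so the degree is only
  bounded by 4.\<close>

lemma P_poly: "\<exists>p. degree p \<le> 4 \<and> poly p = P"
proof -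
  let ?p = "[:B\<^sup>2, 2 * A * B - A' * c1 * B, A\<^sup>2 - 2 * B + c1 * c2 * B - A' * c1 * A - B' * c1\<^sup>2,
      - 2 * A + c1 * c2 * A + A' * c1, 1 - c1 * c2:]"
  have "poly ?p = P"
    by (rule ext) (simp add: P_def W_def power2_eq_square algebra_simps)
  moreover have "degree ?p \<le> 4" by simp
  ultimately show ?thesis by blast
qed

lemma v_pos: "0 < u \<Longrightarrow> u < s \<Longrightarrow> v u > 0"
  using W_pos_iff c1 by (simp add: v_def)

lemma W_v: "u > 0 \<Longrightarrow> W u = c1 * u * v u"
  using c1 by (simp add: v_def)

text \<open>For positive \<open>u\<close>, \<open>c1 * v u\<close> equals
  \<open>A - u + B / u\<close>, which is decreasing. Hence the curve \<open>E\<close> is a chain in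
  the south-east order.\<close>

lemma v_anti:
  assumes "0 < u" "u < u'"
  shows "v u' < v u"
proof -
  have v: "v x = (A - x + B / x) / c1" if "x > 0" for x
    using that c1 by (simp add: v_def W_def field_simps power2_eq_square)
  have "B / u' < B / u" using assms B_pos by (intro divide_strict_left_mono) auto
  then show ?thesis using assms c1 by (simp add: v divide_strict_right_mono)
qed

lemma P_eq_G: "u > 0 \<Longrightarrow> P u = - ((c1 * u)\<^sup>2 * G u (v u))"
  unfolding P_def G_def by (simp add: W_v) (simp add: power2_eq_square algebra_simps)

lemma E_quadrant: "0 < u \<Longrightarrow> u < s \<Longrightarrow> E u \<in> quadrant"
  using v_pos[of u] h1 h2 by (simp add: E_def mem_quadrant_iff)

lemma E_less: "0 < u \<Longrightarrow> u < u' \<Longrightarrow> E u \<lless> E u'"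
  using v_anti by (simp add: se_less_def E_def)

lemma fst_T_E:
  assumes "0 < u" "u < s"
  shows "fst (T (E u)) = fst (E u)"
proof -
  have "den1 (E u) > 0" using den1_pos E_quadrant assms by blast
  moreover have "b1 * (h1 + u) = u * den1 (E u)"
    using W_v[OF assms(1)] by (simp add: W_def A_def B_def E_def den1_def power2_eq_square algebra_simps)
  ultimately show ?thesis by (simp add: fst_T E_def)
qed

lemma snd_T_E:
  assumes "0 < u" "u < s"
  shows "snd (T (E u)) - snd (E u) = G u (v u) / den2 (E u)"
proof -
  have "den2 (E u) > 0" using den2_pos E_quadrant assms by blast
  moreover have "b2 * (h2 + v u) = v u * den2 (E u) + G u (v u)"
    by (simp add: G_def A'_def B'_def E_def den2_def power2_eq_square algebra_simps)
  ultimately show ?thesis by (simp add: snd_T E_def field_simps)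
qed

text \<open>On the curve \<open>T\<close> preserves the first coordinate, so a point and its image
  are always comparable. The direction of the vertical displacement is the sign of \<open>G\<close>,
  which is opposite to that of \<open>P\<close>.\<close>

lemma T_E_le_iff:
  assumes "0 < u" "u < s"
  shows "T (E u) \<preceq>\<^sub>s\<^sub>e E u \<longleftrightarrow> P u \<le> 0" "E u \<preceq>\<^sub>s\<^sub>e T (E u) \<longleftrightarrow> P u \<ge> 0"
proof -
  have "den2 (E u) > 0" using den2_pos E_quadrant assms by blast
  then have "snd (E u) \<le> snd (T (E u)) \<longleftrightarrow> G u (v u) \<ge> 0"
    "snd (T (E u)) \<le> snd (E u) \<longleftrightarrow> G u (v u) \<le> 0"
    using snd_T_E[OF assms] by (smt (verit) divide_nonneg_pos divide_neg_pos divide_pos_pos divide_nonpos_pos)+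
  then show "T (E u) \<preceq>\<^sub>s\<^sub>e E u \<longleftrightarrow> P u \<le> 0" "E u \<preceq>\<^sub>s\<^sub>e T (E u) \<longleftrightarrow> P u \<ge> 0"
    using assms c1 fst_T_E[OF assms]
    by (auto simp: se_le_def P_eq_G zero_le_mult_iff mult_le_0_iff)
qed

lemma equilibria_eq: "equilibria T = E ` {u. 0 < u \<and> u < s \<and> P u = 0}"
proof (intro equalityI subsetI)
  fix p assume p: "p \<in> equilibria T"
  note pp = equilibrium_pos[OF p]
  define u w where "u = fst p - h1" and "w = snd p - h2"
  have D: "den1 p > 0" "den2 p > 0" using pp den1_pos den2_pos by auto
  have u: "u = b1 * fst p / den1 p" and w: "w = b2 * snd p / den2 p"
    using fst_T[of p] snd_T[of p] pp by (auto simp: u_def w_def)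
  have u0: "u > 0" and w0: "w > 0" using u w D pp b1 b2 by auto
  have "u * den1 p = b1 * fst p" using u D by simp
  then have "W u = c1 * u * w"
    by (simp add: W_def A_def B_def u_def w_def den1_def power2_eq_square algebra_simps)
  then have v: "v u = w" using u0 c1 by (simp add: v_def)
  \<comment> \<open>The second coordinate of the equilibrium exceeds \<open>h2\<close>, so
    \<open>W u\<close> is positive, which places \<open>u\<close> to the left of
    \<open>s\<close>.\<close>
  then have us: "u < s" using W_pos_iff[OF u0] \<open>W u = _\<close> c1 u0 w0 by simp
  have E: "E u = p" by (simp add: E_def v prod_eq_iff) (simp add: u_def w_def)
  have "P u = 0"
    using T_E_le_iff[OF u0 us] pp unfolding E by simp
  then show "p \<in> E ` {u. 0 < u \<and> u < s \<and> P u = 0}" using u0 us E by blast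
next
  fix p assume "p \<in> E ` {u. 0 < u \<and> u < s \<and> P u = 0}"
  then obtain u where u: "p = E u" "0 < u" "u < s" "P u = 0" by blast
  then have "T p = p" using T_E_le_iff[OF u(2,3)] by (auto intro: se_le_antisym)
  then show "p \<in> equilibria T" using u E_quadrant by (simp add: equilibria_def)
qed

lemma E_inj: "inj_on E {u. 0 < u \<and> u < s \<and> P u = 0}"
  by (auto simp: inj_on_def E_def)

lemma E_le_iff: "0 < u \<Longrightarrow> 0 < u' \<Longrightarrow> E u \<preceq>\<^sub>s\<^sub>e E u' \<longleftrightarrow> u \<le> u'"
  using v_anti[of u u'] by (cases "u = u'") (auto simp: se_le_def E_def)

lemma P_factor:
  assumes "0 < a" "a < s" "P a = 0" "0 < b" "b < s" "P b = 0" "a \<noteq> b"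
  shows "\<exists>t l m. 0 < t \<and> t < s \<and> (\<forall>x. P x = (x - a) * (x - b) * (x - t) * (l + m * x)) \<and>
    (\<forall>x. 0 \<le> x \<and> x \<le> s \<longrightarrow> l + m * x < 0)"
proof -
  obtain p where p: "degree p \<le> 4" "poly p = P" using P_poly by blast
  show ?thesis
    using poly_factor_two_roots[of p s a b, unfolded p(2), OF p(1) P_0 P_s assms] .
qed

lemma equilibria_exist: "equilibria T \<noteq> {}"
proof -
  obtain p where "degree p \<le> 4" "poly p = P" using P_poly by blast
  then obtain u where "0 < u" "u < s" "P u = 0"
    using poly_IVT_neg[of 0 s p] P_0 P_s s_pos by metis
  then show ?thesis unfolding equilibria_eq by blast
qed

lemma equilibria_card: "finite (equilibria T)" "card (equilibria T) \<le> 3"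
proof -
  let ?R = "{u. 0 < u \<and> u < s \<and> P u = 0}"
  have "\<exists>S. ?R \<subseteq> S \<and> finite S \<and> card S \<le> 3"
  proof (cases "\<exists>a\<in>?R. \<exists>b\<in>?R. a \<noteq> b")
    case True
    then obtain a b where ab: "0 < a" "a < s" "P a = 0" "0 < b" "b < s" "P b = 0" "a \<noteq> b" by auto
    obtain t l m where "0 < t" "t < s" and t: "\<forall>x. P x = (x - a) * (x - b) * (x - t) * (l + m * x)"
      "\<forall>x. 0 \<le> x \<and> x \<le> s \<longrightarrow> l + m * x < 0"
      using P_factor[OF ab] by blast
    \<comment> \<open>The affine factor has no zero on the interval, so every zero of
      \<open>P\<close> there comes from one of the other three factors.\<close>
    have "?R \<subseteq> {a, b, t}"
    proof
      fix x assume x: "x \<in> ?R"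
      then have "l + m * x \<noteq> 0" using t(2)[rule_format, of x] by auto
      then show "x \<in> {a, b, t}" using x t(1)[rule_format, of x] by auto
    qed
    moreover have "card {a, b, t} \<le> 3" by (simp add: card_insert_if)
    ultimately show ?thesis by blast
  next
    case False
    obtain a where "a \<in> ?R \<or> ?R = {}" by blast
    then have "?R \<subseteq> {a}" using False by blast
    moreover have "card {a} \<le> 3" by simp
    ultimately show ?thesis by blast
  qed
  then obtain S where S: "?R \<subseteq> S" "finite S" "card S \<le> 3" by blast
  have "finite ?R" "card ?R \<le> 3"
    using finite_subset[OF S(1,2)] card_mono[OF S(2,1)] S(3) by linarith+
  then show "finite (equilibria T)" "card (equilibria T) \<le> 3"
    unfolding equilibria_eq card_image[OF E_inj] by simp_all
qed

lemma equilibria_linear_order: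
  "linear_order_on (equilibria T) (relation_of (\<preceq>\<^sub>s\<^sub>e) (equilibria T))"
proof -
  let ?r = "relation_of (\<preceq>\<^sub>s\<^sub>e) (equilibria T)"
  have "trans ?r"
    unfolding trans_def relation_of_def using se_le_trans by blast
  moreover have "antisym ?r"
    unfolding antisym_def relation_of_def using se_le_antisym by blast
  moreover have "p \<preceq>\<^sub>s\<^sub>e q \<or> q \<preceq>\<^sub>s\<^sub>e p" if "p \<in> equilibria T" "q \<in> equilibria T" for p q
    using that unfolding equilibria_eq by (auto simp: E_le_iff)
  then have "total_on (equilibria T) ?r"
    unfolding total_on_def relation_of_def by blast
  moreover have "refl_on (equilibria T) ?r" "?r \<subseteq> equilibria T \<times> equilibria T"
    by (auto simp: refl_on_def relation_of_def)
  ultimately show ?thesis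
    unfolding order_on_defs by blast
qed

section \<open>The derivative of the quartic and stability\<close>

lemma P_derivative:
  "(P has_real_derivative
     2 * W u * (A - 2 * u) + c1 * c2 * (2 * u * W u + u\<^sup>2 * (A - 2 * u))
     - A' * c1 * (W u + u * (A - 2 * u)) - 2 * B' * c1\<^sup>2 * u) (at u)"
  unfolding P_def W_def
  by (auto intro!: derivative_eq_intros simp: power2_eq_square algebra_simps)

text \<open>The sign of \<open>P'\<close> at a root is opposite to the sign of \<open>det (1 - J)\<close>, where \<open>J\<close> is the
  Jacobian matrix at the equilibrium.\<close>

lemma P_derivative_root:
  assumes u: "0 < u" "u < s" "P u = 0"
  defines "p \<equiv> E u"
  shows "(P has_real_derivative - (c1 * u * den1 p * den2 p *
     ((1 - q11 p p) * (1 - q22 p p) - q12 p p * q21 p p))) (at u)"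
proof -
  define x y where "x = h1 + u" and "y = h2 + v u"
  have p: "fst p = x" "snd p = y" by (auto simp: p_def E_def x_def y_def)
  have pE: "p \<in> equilibria T" using u unfolding p_def equilibria_eq by blast
  note pp = equilibrium_pos[OF pE]
  define D1 D2 where "D1 = den1 p" and "D2 = den2 p"
  have D: "D1 > 0" "D2 > 0" using pp den1_pos den2_pos by (auto simp: D1_def D2_def)
  have Wv: "W u = c1 * u * v u" using W_v u by blast
  have G0: "G u (v u) = 0" using P_eq_G[OF u(1)] u c1 by simp
  have e1: "b1 * x = u * D1" using fst_T[of p] pp(4) D p by (simp add: D1_def x_def field_simps)
  have e2: "b2 * y = v u * D2" using snd_T[of p] pp(4) D p by (simp add: D2_def y_def field_simps)
  have D1: "D1 = 1 + x + c1 * y" and D2: "D2 = 1 + y + c2 * x"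
    by (auto simp: D1_def D2_def den1_def den2_def p)
  \<comment> \<open>The fixed point equations \<open>e1\<close> and \<open>e2\<close> turn
    \<open>b1 * x / D1\<close> into \<open>u\<close> and \<open>b2 * y / D2\<close> into
    \<open>v u\<close>, so the scaled entries become polynomials in \<open>u\<close> and
    \<open>v u\<close>.\<close>
  have f1: "D1 * (1 - q11 p p) = - (A - 2 * u - c1 * v u)"
  proof -
    have "D1 * q11 p p = b1 * (D1 - x) / D1" using D by (simp add: q11_def p D1_def[symmetric] D1)
    also have "\<dots> = b1 - u" using D e1 by (simp add: field_simps)
    finally show ?thesis using D1 by (simp add: A_def x_def y_def algebra_simps)
  qed
  have f2: "D2 * (1 - q22 p p) = - (A' - 2 * v u - c2 * u)"
  proof -
    have "D2 * q22 p p = b2 * (D2 - y) / D2" using D by (simp add: q22_def p D2_def[symmetric] D2)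
    also have "\<dots> = b2 - v u" using D e2 by (simp add: field_simps)
    finally show ?thesis using D2 by (simp add: A'_def x_def y_def algebra_simps)
  qed
  have f3: "D1 * q12 p p = c1 * u" using D e1 by (simp add: q12_def p D1_def[symmetric] field_simps)
  have f4: "D2 * q21 p p = c2 * v u" using D e2 by (simp add: q21_def p D2_def[symmetric] field_simps)
  have "c1 * u * D1 * D2 * ((1 - q11 p p) * (1 - q22 p p) - q12 p p * q21 p p)
    = c1 * u * ((D1 * (1 - q11 p p)) * (D2 * (1 - q22 p p)) - (D1 * q12 p p) * (D2 * q21 p p))"
    by (simp add: algebra_simps)
  also have "\<dots> = c1 * u * ((A - 2 * u - c1 * v u) * (A' - 2 * v u - c2 * u) - c1 * u * c2 * v u)"
    unfolding f1 f2 f3 f4 by (simp only: minus_mult_minus mult.assoc)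
  finally have lhs: "c1 * u * D1 * D2 * ((1 - q11 p p) * (1 - q22 p p) - q12 p p * q21 p p) = \<dots>" .
  \<comment> \<open>Eliminating \<open>B'\<close> by \<open>G0\<close> and \<open>W u\<close> by
    \<open>Wv\<close> leaves a polynomial identity to check.\<close>
  have B': "B' = (v u)\<^sup>2 + c2 * u * v u - A' * v u" using G0 by (simp add: G_def)
  show ?thesis
    using P_derivative[of u] unfolding lhs[unfolded D1_def D2_def] Wv B'
    by (rule DERIV_cong) (simp add: power2_eq_square algebra_simps)
qed

text \<open>\<open>P\<close> is positive just to the left of \<open>u\<close> and negative just to
  the right. Hence \<open>T\<close> moves \<open>E (u - h)\<close> up and \<open>E (u + h)\<close>
  down in the south-east order, and \<open>u\<close> is the only zero of \<open>P\<close> in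
  between.\<close>

lemma stable_if_P_decreasing:
  assumes u: "0 < u" "u < s" "P u = 0" and d: "(P has_real_derivative d) (at u)" "d < 0"
  shows "locally_asymptotically_stable T (E u)"
proof -
  obtain \<delta>1 where \<delta>1: "\<delta>1 > 0" "\<And>h. 0 < h \<Longrightarrow> h < \<delta>1 \<Longrightarrow> P (u - h) > 0"
    using DERIV_neg_dec_left[OF d] u(3) by auto
  obtain \<delta>2 where \<delta>2: "\<delta>2 > 0" "\<And>h. 0 < h \<Longrightarrow> h < \<delta>2 \<Longrightarrow> P (u + h) < 0"
    using DERIV_neg_dec_right[OF d] u(3) by auto
  \<comment> \<open>Halving makes all four bounds strict; \<open>u\<close> and \<open>s - u\<close>
    keep both corners on the curve.\<close>
  define h where "h = Min {\<delta>1, \<delta>2, u, s - u} / 2"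
  have h: "0 < h" "h < \<delta>1" "h < \<delta>2" "h < u" "h < s - u"
    using \<delta>1(1) \<delta>2(1) u(1,2) by (auto simp: h_def)
  show ?thesis
  proof (rule interval_stable)
    show "E (u - h) \<in> quadrant" "E (u + h) \<in> quadrant" using h by (auto intro!: E_quadrant)
    show "E (u - h) \<preceq>\<^sub>s\<^sub>e T (E (u - h))" "T (E (u + h)) \<preceq>\<^sub>s\<^sub>e E (u + h)"
      using T_E_le_iff[of "u - h"] T_E_le_iff[of "u + h"] h \<delta>1(2)[of h] \<delta>2(2)[of h] by auto
    show "E (u - h) \<lless> E u" "E u \<lless> E (u + h)" using h u by (auto intro!: E_less)
    show "E u \<in> equilibria T" using u unfolding equilibria_eq by blast
    fix e assume e: "e \<in> equilibria T" "E (u - h) \<preceq>\<^sub>s\<^sub>e e" "e \<preceq>\<^sub>s\<^sub>e E (u + h)"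
    then obtain w where w: "e = E w" "0 < w" "P w = 0" unfolding equilibria_eq by blast
    then have "u - h \<le> w" "w \<le> u + h" using e E_le_iff h by auto
    then have "w = u"
      using w(3) \<delta>1(2)[of "u - w"] \<delta>2(2)[of "w - u"] h by (cases w u rule: linorder_cases) auto
    then show "e = E u" using w by simp
  qed
qed

end

section \<open>Linearization at an equilibrium\<close>

lemma eigenvalue_2x2:
  fixes a b c d k :: complex
  assumes "b \<noteq> 0" "(a - k) * (d - k) = b * c"
  shows "eigenvalue (mat_of_rows_list 2 [[a, b], [c, d]]) k"
proof -
  let ?M = "mat_of_rows_list 2 [[a, b], [c, d]]"
  \<comment> \<open>This vector satisfies the first row of the eigenvector equation for every
    \<open>k\<close>; the second row is the characteristic equation.\<close>
  let ?x = "vec_of_list [b, k - a]"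
  have "c * b + d * (k - a) = k * (k - a) + (b * c - (a - k) * (d - k))"
    by (simp add: algebra_simps)
  then have e: "c * b + d * (k - a) = k * (k - a)"
    by (simp only: assms(2) diff_self add_0_right)
  have dim: "dim_row ?M = 2" "dim_col ?M = 2" by (auto simp: mat_of_rows_list_def)
  have "vec_index ?x 0 \<noteq> vec_index (0\<^sub>v 2) 0" using assms(1) by simp
  then have "?x \<noteq> 0\<^sub>v 2" by (rule contrapos_nn) (rule arg_cong)
  moreover have "?M *\<^sub>v ?x = k \<cdot>\<^sub>v ?x"
  proof (rule eq_vecI)
    fix i assume "i < dim_vec (k \<cdot>\<^sub>v ?x)"
    then have "i = 0 \<or> i = 1" by auto
    then show "vec_index (?M *\<^sub>v ?x) i = vec_index (k \<cdot>\<^sub>v ?x) i"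
      using e by (auto simp: mat_of_rows_list_def scalar_prod_def numeral_2_eq_2)
        (simp add: algebra_simps)
  qed (simp add: dim)
  moreover have "?x \<in> carrier_vec 2" by (rule carrier_vecI) simp
  ultimately show ?thesis
    unfolding eigenvalue_def eigenvector_def dim by (intro exI[of _ ?x] conjI)
qed

context leslie_gower
begin

lemma T_has_derivative:
  assumes "p \<in> quadrant"
  shows "(T has_derivative (\<lambda>d. (q11 p p * fst d - q12 p p * snd d, - q21 p p * fst d + q22 p p * snd d))) (at p)"
proof -
  have D: "den1 p \<noteq> 0" "den2 p \<noteq> 0"
    using den1_pos[OF assms] den2_pos[OF assms] by auto
  have num: "1 + c1 * snd p = den1 p - fst p" "1 + c2 * fst p = den2 p - snd p"
    by (auto simp: den1_def den2_def)
  \<comment> \<open>Brings the output of the quotient rule into the form of the entries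
    \<open>q11\<close> to \<open>q22\<close>; it serves both components.\<close>
  have quot: "b * s / D - b * x * (inverse D * (s + c * t) * inverse D)
      = b * (D - x) / (D * D) * s - b * c * x / (D * D) * t" if "D \<noteq> 0" for b s D x c t :: real
    using that by (simp add: divide_simps) (simp add: algebra_simps)
  have d: "(den1 has_derivative (\<lambda>d. fst d + c1 * snd d)) (at p)"
    "(den2 has_derivative (\<lambda>d. snd d + c2 * fst d)) (at p)"
    unfolding den1_def[abs_def] den2_def[abs_def] by (auto intro!: derivative_eq_intros)
  have "((\<lambda>z. b1 * fst z / den1 z + h1) has_derivative
      (\<lambda>d. q11 p p * fst d - q12 p p * snd d)) (at p)"
    by (rule has_derivative_eq_rhs, rule has_derivative_add[OF has_derivative_divide[OF
          has_derivative_mult_right[OF has_derivative_fst[OF has_derivative_ident]] d(1) D(1)]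
          has_derivative_const])
       (rule ext, simp add: q11_def q12_def num quot[OF D(1)])
  moreover have "((\<lambda>z. b2 * snd z / den2 z + h2) has_derivative
      (\<lambda>d. - q21 p p * fst d + q22 p p * snd d)) (at p)"
    by (rule has_derivative_eq_rhs, rule has_derivative_add[OF has_derivative_divide[OF
          has_derivative_mult_right[OF has_derivative_snd[OF has_derivative_ident]] d(2) D(2)]
          has_derivative_const])
       (rule ext, simp add: q21_def q22_def num quot[OF D(2)])
  moreover have "T = (\<lambda>z. (b1 * fst z / den1 z + h1, b2 * snd z / den2 z + h2))"
    using fst_T snd_T by (intro ext prod_eqI) auto
  ultimately show ?thesis
    by (simp only:) (rule has_derivative_Pair)
qed

lemma jacobian_matrix_T:
  assumes "p \<in> quadrant"
  shows "jacobian_matrix T p = mat_of_rows_list 2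
    [[complex_of_real (q11 p p), complex_of_real (- q12 p p)],
     [complex_of_real (- q21 p p), complex_of_real (q22 p p)]]"
  unfolding jacobian_matrix_def frechet_derivative_at[OF T_has_derivative[OF assms], symmetric]
  by simp

text \<open>As \<open>h1\<close> is positive, the fixed point equation gives
  \<open>b1 < den1 p\<close>. Together with \<open>1 + c1 * snd p < den1 p\<close> this bounds
  \<open>q11\<close> below 1, and \<open>q22\<close> is treated alike. The off-diagonal entries are
  positive because equilibria have positive coordinates.\<close>

lemma equilibrium_q:
  assumes "p \<in> equilibria T"
  shows "0 < q11 p p" "q11 p p < 1" "0 < q12 p p" "0 < q21 p p" "0 < q22 p p" "q22 p p < 1"
proof -
  note pp = equilibrium_pos[OF assms]
  have D: "den1 p > 0" "den2 p > 0" using pp den1_pos den2_pos by auto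
  have "fst p - b1 * fst p / den1 p > 0" "snd p - b2 * snd p / den2 p > 0"
    using fst_T[of p] snd_T[of p] pp(4) h1 h2 by auto
  then have "b1 < den1 p" "b2 < den2 p"
    using D pp by (auto simp: field_simps)
  then have "b1 * (1 + c1 * snd p) < den1 p * den1 p" "b2 * (1 + c2 * fst p) < den2 p * den2 p"
    using pp b1 b2 c1 c2 by (intro mult_strict_mono; simp add: den1_def den2_def)+
  then show "q11 p p < 1" "q22 p p < 1" using D by (auto simp: q11_def q22_def)
  show "0 < q11 p p" "0 < q12 p p" "0 < q21 p p" "0 < q22 p p"
    using D pp b1 b2 c1 c2 q_signs[OF pp(3) pp(3)] by (auto simp: q12_def q21_def)
qed

lemma jacobian_eigenvalue:
  assumes "p \<in> equilibria T" "(q11 p p - k) * (q22 p p - k) = q12 p p * q21 p p"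
  shows "eigenvalue (jacobian_matrix T p) (complex_of_real k)"
proof -
  have "(complex_of_real (q11 p p) - complex_of_real k) * (complex_of_real (q22 p p) - complex_of_real k)
      = complex_of_real (- q12 p p) * complex_of_real (- q21 p p)"
    using arg_cong[OF assms(2), of complex_of_real] by simp
  then show ?thesis
    using equilibrium_q[OF assms(1)] equilibrium_pos(3)[OF assms(1)]
    by (auto simp: jacobian_matrix_T intro!: eigenvalue_2x2)
qed

lemma nonhyperbolic_if_det_zero:
  assumes "p \<in> equilibria T" "(1 - q11 p p) * (1 - q22 p p) = q12 p p * q21 p p"
  shows "nonhyperbolic T p"
  unfolding nonhyperbolic_def
  using jacobian_eigenvalue[OF assms(1), of 1] assms(2)
  by (intro exI[of _ 1]) (simp add: algebra_simps)

text \<open>The characteristic polynomial \<open>f\<close> is positive at 0, where it is the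
  determinant, negative at \<open>q11 p p\<close> and at 1, and positive far to the right. So it has
  a root in \<open>[0, q11 p p]\<close> and one beyond 1.\<close>

lemma saddle_if_det_neg:
  assumes p: "p \<in> equilibria T" and det: "(1 - q11 p p) * (1 - q22 p p) < q12 p p * q21 p p"
  shows "saddle_point T p"
proof -
  note q = equilibrium_q[OF p]
  define e where "e = q12 p p * q21 p p"
  define f where "f k = (q11 p p - k) * (q22 p p - k) - e" for k
  have cont: "continuous_on S f" for S
    unfolding f_def by (intro continuous_intros)
  have e: "e > 0" using q by (simp add: e_def)
  have "f 0 > 0" using q_det[of p p] equilibrium_pos[OF p] by (simp add: f_def e_def)
  moreover have "f (q11 p p) < 0" using e by (simp add: f_def)
  ultimately obtain \<nu> where \<nu>: "0 \<le> \<nu>" "\<nu> \<le> q11 p p" "f \<nu> = 0"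
    using IVT2'[of f "q11 p p" 0 0] q cont by auto
  \<comment> \<open>At \<open>2 + e\<close> both factors have absolute value at least
    \<open>1 + e\<close>, because the diagonal entries are below 1.\<close>
  have "e < (1 + e) * (1 + e)"
    using e by (simp add: algebra_simps add_pos_pos)
  also have "\<dots> \<le> (q11 p p - (2 + e)) * (q22 p p - (2 + e))"
    using q e mult_mono[of "1 + e" "2 + e - q11 p p" "1 + e" "2 + e - q22 p p"]
    by (simp add: algebra_simps)
  finally have "f (2 + e) > 0" by (simp add: f_def)
  moreover have "f 1 < 0" using det by (simp add: f_def e_def algebra_simps)
  ultimately obtain \<mu> where \<mu>: "1 \<le> \<mu>" "f \<mu> = 0"
    using IVT'[of f 1 0 "2 + e"] cont e by auto
  have "\<mu> \<noteq> 1" using \<mu> \<open>f 1 < 0\<close> by auto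
  have "eigenvalue (jacobian_matrix T p) (complex_of_real \<nu>)"
    "eigenvalue (jacobian_matrix T p) (complex_of_real \<mu>)"
    using \<nu>(3) \<mu>(2) by (auto simp: f_def e_def intro!: jacobian_eigenvalue p)
  moreover have "cmod (complex_of_real \<nu>) < 1" "cmod (complex_of_real \<mu>) > 1"
    using \<nu> \<mu> \<open>\<mu> \<noteq> 1\<close> q by auto
  ultimately show ?thesis unfolding saddle_point_def by blast
qed

section \<open>Ordered orbits near a saddle point\<close>

lemma q_tendsto:
  assumes "p \<in> quadrant" "X \<longlonglongrightarrow> p" "Y \<longlonglongrightarrow> p"
  shows "(\<lambda>n. q11 (X n) (Y n)) \<longlonglongrightarrow> q11 p p" "(\<lambda>n. q12 (X n) (Y n)) \<longlonglongrightarrow> q12 p p"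
    "(\<lambda>n. q21 (X n) (Y n)) \<longlonglongrightarrow> q21 p p" "(\<lambda>n. q22 (X n) (Y n)) \<longlonglongrightarrow> q22 p p"
  using den1_pos[OF assms(1)] den2_pos[OF assms(1)]
  unfolding q11_def q12_def q21_def q22_def den1_def den2_def
  by (auto intro!: tendsto_intros assms)

text \<open>For a suitable \<open>r > 0\<close> the functional \<open>(\<xi>, \<eta>) \<mapsto> \<xi> - r \<eta>\<close> increases along the difference of two
  ordered orbits close to \<open>p\<close>, so these cannot both converge to \<open>p\<close>.\<close>

lemma saddle_basin_antichain:
  assumes p: "p \<in> equilibria T" and det: "(1 - q11 p p) * (1 - q22 p p) < q12 p p * q21 p p"
    and z: "z \<in> basin T p" and w: "w \<in> basin T p" and le: "z \<preceq>\<^sub>s\<^sub>e w"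
  shows "z = w"
proof (rule ccontr)
  assume "z \<noteq> w"
  note q = equilibrium_q[OF p]
  \<comment> \<open>Negativity of \<open>det (1 - J)\<close> is exactly what leaves room for
    \<open>r\<close>. In the coordinates in which all entries are positive, the row vector
    \<open>(1, r)\<close> times the Jacobian then exceeds \<open>(1, r)\<close> in both
    components.\<close>
  have "(1 - q11 p p) / q21 p p < q12 p p / (1 - q22 p p)"
    using det q by (simp add: field_simps)
  then obtain r where r: "(1 - q11 p p) / q21 p p < r" "r < q12 p p / (1 - q22 p p)"
    using dense by blast
  have "0 < (1 - q11 p p) / q21 p p" using q by simp
  then have r0: "r > 0" using r by linarith
  define X Y where "X = (\<lambda>n. (T ^^ n) z)" and "Y = (\<lambda>n. (T ^^ n) w)"
  have lim: "X \<longlonglongrightarrow> p" "Y \<longlonglongrightarrow> p" and Q: "X n \<in> quadrant" "Y n \<in> quadrant" for n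
    using z w orbit_quadrant by (auto simp: basin_def X_def Y_def)
  note ql = q_tendsto[OF equilibrium_pos(3)[OF p] lim]
  have "(\<lambda>n. q11 (X n) (Y n) + r * q21 (X n) (Y n)) \<longlonglongrightarrow> q11 p p + r * q21 p p"
    "(\<lambda>n. q12 (X n) (Y n) + r * q22 (X n) (Y n)) \<longlonglongrightarrow> q12 p p + r * q22 p p"
    by (intro tendsto_intros ql)+
  moreover have "1 < q11 p p + r * q21 p p" "r < q12 p p + r * q22 p p"
    using r q by (auto simp: field_simps)
  \<comment> \<open>The difference quotients tend to the Jacobian along the two orbits, so the
    strict inequalities eventually hold for them too.\<close>
  ultimately have "\<forall>\<^sub>F n in sequentially. 1 < q11 (X n) (Y n) + r * q21 (X n) (Y n) \<and>
      r < q12 (X n) (Y n) + r * q22 (X n) (Y n)"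
    by (intro eventually_conj order_tendstoD(1))
  then obtain N where N: "\<And>n. n \<ge> N \<Longrightarrow> 1 < q11 (X n) (Y n) + r * q21 (X n) (Y n)"
    "\<And>n. n \<ge> N \<Longrightarrow> r < q12 (X n) (Y n) + r * q22 (X n) (Y n)"
    unfolding eventually_sequentially by blast
  define V where "V n = (fst (Y n) - fst (X n)) + r * (snd (X n) - snd (Y n))" for n
  have ord: "fst (X n) \<le> fst (Y n)" "snd (Y n) \<le> snd (X n)" for n
    using orbit_mono[of z w n] z w le by (auto simp: X_def Y_def basin_def se_le_def)
  have step: "V n \<le> V (Suc n)" if "n \<ge> N" for n
  proof -
    have S: "X (Suc n) = T (X n)" "Y (Suc n) = T (Y n)" by (auto simp: X_def Y_def)
    have "V n = 1 * (fst (Y n) - fst (X n)) + r * (snd (X n) - snd (Y n))"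
      by (simp add: V_def)
    also have "\<dots> \<le> (q11 (X n) (Y n) + r * q21 (X n) (Y n)) * (fst (Y n) - fst (X n))
        + (q12 (X n) (Y n) + r * q22 (X n) (Y n)) * (snd (X n) - snd (Y n))"
      using N[OF that] ord by (intro add_mono mult_right_mono) (simp_all add: less_imp_le)
    also have "\<dots> = V (Suc n)"
      unfolding V_def S fst_T_diff[OF Q] snd_T_diff[OF Q] by (simp add: algebra_simps)
    finally show ?thesis .
  qed
  have mono: "V N \<le> V n" if "n \<ge> N" for n
    using that by (induction rule: dec_induct) (auto intro: order_trans step)
  have "V \<longlonglongrightarrow> (fst p - fst p) + r * (snd p - snd p)"
    unfolding V_def by (intro tendsto_intros lim)
  then have "V \<longlonglongrightarrow> 0" by simp
  then have "V N \<le> 0" using mono by (intro LIMSEQ_le_const) auto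
  \<comment> \<open>By injectivity the two orbits never meet, so the nondecreasing \<open>V\<close>
    starts at a positive value and cannot tend to 0.\<close>
  moreover have "V N > 0"
  proof -
    have "X N \<noteq> Y N" using orbit_inj[of z w N] z w \<open>z \<noteq> w\<close> by (auto simp: X_def Y_def basin_def)
    then have "fst (Y N) - fst (X N) > 0 \<or> snd (X N) - snd (Y N) > 0"
      using ord[of N] by (auto simp: prod_eq_iff)
    then show ?thesis
      using ord[of N] r0 by (auto simp: V_def intro: add_pos_nonneg add_nonneg_pos)
  qed
  ultimately show False by simp
qed

section \<open>Openness of basins\<close>

lemma basin_subset_quadrant: "basin T p \<subseteq> quadrant"
  by (auto simp: basin_def)

lemma orbit_in_basin_iff: "z \<in> quadrant \<Longrightarrow> (T ^^ n) z \<in> basin T p \<longleftrightarrow> z \<in> basin T p"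
proof -
  assume z: "z \<in> quadrant"
  have "(T ^^ k) ((T ^^ n) z) = (T ^^ (k + n)) z" for k by (simp add: funpow_add)
  then show ?thesis
    using z orbit_quadrant[OF z, of n] LIMSEQ_ignore_initial_segment[of "\<lambda>k. (T ^^ k) z" p n]
      LIMSEQ_offset[of "\<lambda>k. (T ^^ k) z" n p]
    by (auto simp: basin_def)
qed

text \<open>An orbit in the basin enters a ball of attracted points at some time \<open>n\<close>;
  by continuity of \<open>T ^^ n\<close> the orbits of nearby points are in this ball at the same
  time.\<close>

lemma openin_basin:
  assumes "locally_asymptotically_stable T p"
  shows "openin (top_of_set quadrant) (basin T p)"
  unfolding openin_euclidean_subtopology_iff
proof (intro conjI ballI basin_subset_quadrant)
  fix z assume z: "z \<in> basin T p"
  obtain \<delta> where \<delta>: "\<delta> > 0" "\<And>w. w \<in> quadrant \<Longrightarrow> dist w p < \<delta> \<Longrightarrow> w \<in> basin T p"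
    using assms unfolding locally_asymptotically_stable_def by blast
  have zQ: "z \<in> quadrant" and "(\<lambda>n. (T ^^ n) z) \<longlonglongrightarrow> p" using z by (auto simp: basin_def)
  then have "\<forall>\<^sub>F n in sequentially. dist ((T ^^ n) z) p < \<delta> / 2"
    using \<delta>(1) by (intro tendstoD) auto
  then obtain n where n: "dist ((T ^^ n) z) p < \<delta> / 2"
    using eventually_happens'[OF sequentially_bot] by blast
  have "\<delta> / 2 > 0" using \<delta>(1) by simp
  then obtain \<epsilon> where \<epsilon>: "\<epsilon> > 0"
      "\<And>w. w \<in> quadrant \<Longrightarrow> dist w z < \<epsilon> \<Longrightarrow> dist ((T ^^ n) w) ((T ^^ n) z) < \<delta> / 2"
    using continuous_on_orbit[of n] zQ unfolding continuous_on_iff by blast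
  have "w \<in> basin T p" if w: "w \<in> quadrant" "dist w z < \<epsilon>" for w
  proof -
    have "dist ((T ^^ n) w) p < \<delta>"
      using \<epsilon>(2)[OF w] n dist_triangle[of "(T ^^ n) w" p "(T ^^ n) z"] by linarith
    then show ?thesis using \<delta>(2) orbit_quadrant[OF w(1)] orbit_in_basin_iff[OF w(1)] by blast
  qed
  then show "\<exists>e>0. \<forall>x'\<in>quadrant. dist x' z < e \<longrightarrow> x' \<in> basin T p" using \<epsilon>(1) by blast
qed

section \<open>Three and two equilibria\<close>

lemma derivative_at_factor:
  assumes "\<And>x. P x = (x - a) * (x - b) * (x - t) * (l + m * x)"
  shows "(P has_real_derivative (a - b) * (a - t) * (l + m * a)) (at a)"
  unfolding assms[abs_def] by (auto intro!: derivative_eq_intros simp: algebra_simps)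

text \<open>The three zeros of \<open>P\<close> are simple and the affine factor is negative, so the
  derivative is negative, positive and negative at them in turn. By \<open>P_derivative_root\<close>
  the middle sign says that \<open>det (1 - J)\<close> is negative at \<open>p2\<close>.\<close>

lemma three_equilibria:
  assumes p: "p1 \<in> equilibria T" "p2 \<in> equilibria T" "p3 \<in> equilibria T"
    and ne: "p1 \<noteq> p2" "p1 \<noteq> p3" "p2 \<noteq> p3" and le: "p1 \<preceq>\<^sub>s\<^sub>e p2" "p2 \<preceq>\<^sub>s\<^sub>e p3"
  shows "equilibria T = {p1, p2, p3}"
    "locally_asymptotically_stable T p1" "locally_asymptotically_stable T p3"
    "(1 - q11 p2 p2) * (1 - q22 p2 p2) < q12 p2 p2 * q21 p2 p2"
proof -
  have "card {p1, p2, p3} = 3" using ne by simp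
  then show "equilibria T = {p1, p2, p3}"
    using card_seteq[OF equilibria_card(1), of "{p1, p2, p3}"] p equilibria_card(2) by auto
  obtain u1 u2 u3 where u: "p1 = E u1" "0 < u1" "u1 < s" "P u1 = 0"
    "p2 = E u2" "0 < u2" "u2 < s" "P u2 = 0" "p3 = E u3" "0 < u3" "u3 < s" "P u3 = 0"
    using p unfolding equilibria_eq by blast
  have lt: "u1 < u2" "u2 < u3"
    using le ne u by (auto simp: E_le_iff order_less_le)
  obtain t l m where t: "0 < t" "t < s" and P: "\<And>x. P x = (x - u1) * (x - u2) * (x - t) * (l + m * x)"
    and L: "\<And>x. 0 \<le> x \<Longrightarrow> x \<le> s \<Longrightarrow> l + m * x < 0"
    using P_factor[OF u(2-4,6-8)] lt(1) by blast
  have L0: "l + m * u1 < 0" "l + m * u2 < 0" "l + m * u3 < 0" using L u by auto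
  \<comment> \<open>None of the factors other than \<open>x - t\<close> vanishes at
    \<open>u3\<close>.\<close>
  have "t = u3" using P[of u3] u lt L0 by auto
  note P = P[unfolded \<open>t = u3\<close>]
  have "(P has_real_derivative (u1 - u2) * (u1 - u3) * (l + m * u1)) (at u1)"
    by (rule derivative_at_factor) (simp add: P)
  moreover have "(u1 - u2) * (u1 - u3) * (l + m * u1) < 0"
    using lt L0 by (intro mult_pos_neg mult_neg_neg) auto
  ultimately show "locally_asymptotically_stable T p1"
    using stable_if_P_decreasing u by blast
  have "(P has_real_derivative (u3 - u1) * (u3 - u2) * (l + m * u3)) (at u3)"
    by (rule derivative_at_factor) (simp add: P)
  moreover have "(u3 - u1) * (u3 - u2) * (l + m * u3) < 0"
    using lt L0 by (intro mult_pos_neg mult_pos_pos) auto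
  ultimately show "locally_asymptotically_stable T p3"
    using stable_if_P_decreasing u by blast
  define K where "K = c1 * u2 * den1 p2 * den2 p2"
  have "(P has_real_derivative (u2 - u1) * (u2 - u3) * (l + m * u2)) (at u2)"
    by (rule derivative_at_factor) (simp add: P)
  moreover have "(u2 - u1) * (u2 - u3) * (l + m * u2) > 0"
    using lt L0 by (intro mult_neg_neg mult_pos_neg) auto
  ultimately have K: "- (K * ((1 - q11 p2 p2) * (1 - q22 p2 p2) - q12 p2 p2 * q21 p2 p2)) > 0"
    using DERIV_unique[OF P_derivative_root[of u2]] u by (auto simp: K_def)
  moreover have "K > 0"
    using c1 u den1_pos[of p2] den2_pos[of p2] equilibrium_pos(3)[OF p(2)] by (simp add: K_def)
  ultimately show "(1 - q11 p2 p2) * (1 - q22 p2 p2) < q12 p2 p2 * q21 p2 p2"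
    by (simp add: mult_less_0_iff)
qed

text \<open>The third root supplied by the factorization belongs to an equilibrium, so it repeats
  \<open>a\<close> or \<open>b\<close>. At the double root the derivative of \<open>P\<close>
  vanishes and the Jacobian has eigenvalue 1; at the simple root the derivative is negative.\<close>

lemma two_equilibria:
  assumes "card (equilibria T) = 2"
  shows "\<exists>p q. equilibria T = {p, q} \<and> p \<noteq> q \<and> locally_asymptotically_stable T p \<and> nonhyperbolic T q"
proof -
  obtain p q where pq: "equilibria T = {p, q}" "p \<noteq> q" using assms unfolding card_2_iff by blast
  obtain a b where ab: "p = E a" "0 < a" "a < s" "P a = 0" "q = E b" "0 < b" "b < s" "P b = 0"
    using pq(1) unfolding equilibria_eq by blast
  have "a \<noteq> b" using ab pq by auto
  \<comment> \<open>Here \<open>x\<close> is the double root and \<open>y\<close> the simple one;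
    the two cases below differ only in which of \<open>a\<close> and \<open>b\<close> is
    which.\<close>
  have main: "locally_asymptotically_stable T (E y) \<and> nonhyperbolic T (E x)"
    if P: "\<And>w. P w = (w - x) * (w - y) * (w - x) * (l + m * w)" and "l + m * y < 0" "x \<noteq> y"
      and x: "0 < x" "x < s" and y: "0 < y" "y < s" for x y l m
  proof
    have "(P has_real_derivative (y - x) * (y - x) * (l + m * y)) (at y)"
      by (rule derivative_at_factor) (simp add: P)
    moreover have "(y - x) * (y - x) * (l + m * y) < 0"
      using that by (intro mult_pos_neg) (auto simp: zero_less_mult_iff)
    ultimately show "locally_asymptotically_stable T (E y)"
      using stable_if_P_decreasing[OF y] P by simp
    have P0: "P x = 0" using P by simp
    have "(P has_real_derivative (x - x) * (x - y) * (l + m * x)) (at x)"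
      by (rule derivative_at_factor) (simp add: P)
    then have "- (c1 * x * den1 (E x) * den2 (E x) *
        ((1 - q11 (E x) (E x)) * (1 - q22 (E x) (E x)) - q12 (E x) (E x) * q21 (E x) (E x))) = 0"
      using DERIV_unique[OF P_derivative_root[OF x P0]] by auto
    moreover have "den1 (E x) > 0" "den2 (E x) > 0"
      using den1_pos den2_pos E_quadrant x by auto
    ultimately have "(1 - q11 (E x) (E x)) * (1 - q22 (E x) (E x)) = q12 (E x) (E x) * q21 (E x) (E x)"
      using c1 x by simp
    then show "nonhyperbolic T (E x)"
      using x P0 by (intro nonhyperbolic_if_det_zero) (auto simp: equilibria_eq)
  qed
  obtain t l m where t: "0 < t" "t < s" and P: "\<And>x. P x = (x - a) * (x - b) * (x - t) * (l + m * x)"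
    and L: "\<And>x. 0 \<le> x \<Longrightarrow> x \<le> s \<Longrightarrow> l + m * x < 0"
    using P_factor[OF ab(2-4,6-8) \<open>a \<noteq> b\<close>] by blast
  have "P t = 0" using P by simp
  then have "E t \<in> {p, q}" using t pq(1) unfolding equilibria_eq by blast
  then have "t = a \<or> t = b" using ab by (auto simp: E_def)
  then show ?thesis
  proof
    assume "t = a"
    then show ?thesis
      using main[of a b l m] P L[of b] ab \<open>a \<noteq> b\<close> pq by (intro exI[of _ q] exI[of _ p]) auto
  next
    assume "t = b"
    then have "P x = (x - b) * (x - a) * (x - b) * (l + m * x)" for x using P by simp
    then show ?thesis
      using main[of b a l m] L[of a] ab \<open>a \<noteq> b\<close> pq by (intro exI[of _ p] exI[of _ q]) auto
  qed
qed

text \<open>Comparison with the constant orbit at \<open>p\<close> or \<open>q\<close> puts the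
  limit on the same side of that equilibrium, which excludes the other one.\<close>

lemma two_equilibria_basins:
  assumes pq: "equilibria T = {p, q}" "p \<noteq> q" "p \<preceq>\<^sub>s\<^sub>e q"
  shows "Q2 p \<inter> quadrant \<subseteq> basin T p" "Q4 q \<inter> quadrant \<subseteq> basin T q"
proof -
  have P: "p \<in> basin T p" "q \<in> basin T q" using pq by (auto intro: equilibrium_in_basin)
  have nle: "\<not> q \<preceq>\<^sub>s\<^sub>e p" using pq se_le_antisym by blast
  show "Q2 p \<inter> quadrant \<subseteq> basin T p"
  proof
    fix z assume z: "z \<in> Q2 p \<inter> quadrant"
    then have "z \<preceq>\<^sub>s\<^sub>e p" by (auto simp: Q2_def se_le_def)
    moreover obtain e where e: "e \<in> equilibria T" "z \<in> basin T e" using z by (blast elim: orbit_converges)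
    ultimately show "z \<in> basin T p" using basin_mono[OF e(2) P(1)] pq nle by auto
  qed
  show "Q4 q \<inter> quadrant \<subseteq> basin T q"
  proof
    fix z assume z: "z \<in> Q4 q \<inter> quadrant"
    then have "q \<preceq>\<^sub>s\<^sub>e z" by (auto simp: Q4_def se_le_def)
    moreover obtain e where e: "e \<in> equilibria T" "z \<in> basin T e" using z by (blast elim: orbit_converges)
    ultimately show "z \<in> basin T q" using basin_mono[OF P(2) e(2)] pq nle by auto
  qed
qed

end

section \<open>The stable manifold of the saddle point\<close>

locale leslie_gower_bistable = leslie_gower +
  fixes p1 p2 p3 :: "real \<times> real"
  assumes equilibria_mem: "p1 \<in> equilibria T" "p2 \<in> equilibria T" "p3 \<in> equilibria T"
    and distinct: "p1 \<noteq> p2" "p1 \<noteq> p3" "p2 \<noteq> p3"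
    and ordered: "p1 \<preceq>\<^sub>s\<^sub>e p2" "p2 \<preceq>\<^sub>s\<^sub>e p3"
begin

abbreviation "B1 \<equiv> basin T p1"
abbreviation "C \<equiv> basin T p2"
abbreviation "B3 \<equiv> basin T p3"

lemmas three = three_equilibria[OF equilibria_mem distinct ordered]

lemma basin_cases: "z \<in> quadrant \<Longrightarrow> z \<in> B1 \<or> z \<in> C \<or> z \<in> B3"
  by (erule orbit_converges) (auto simp: three(1))

lemma basins_disjoint: "z \<in> B1 \<Longrightarrow> z \<notin> C" "z \<in> B1 \<Longrightarrow> z \<notin> B3" "z \<in> C \<Longrightarrow> z \<notin> B3"
  using basin_unique distinct by blast+

lemma not_ge: "\<not> p2 \<preceq>\<^sub>s\<^sub>e p1" "\<not> p3 \<preceq>\<^sub>s\<^sub>e p1" "\<not> p3 \<preceq>\<^sub>s\<^sub>e p2"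
  using ordered distinct se_le_antisym se_le_trans by metis+

section \<open>Order structure of the three basins\<close>

lemma B1_down:
  assumes "z \<in> B1" "w \<in> quadrant" "w \<preceq>\<^sub>s\<^sub>e z"
  shows "w \<in> B1"
  using basin_cases[OF assms(2)] basin_mono[OF _ assms(1,3)] not_ge by blast

lemma B3_up:
  assumes "z \<in> B3" "w \<in> quadrant" "z \<preceq>\<^sub>s\<^sub>e w"
  shows "w \<in> B3"
  using basin_cases[OF assms(2)] basin_mono[OF assms(1) _ assms(3)] not_ge by blast

lemma C_antichain: "z \<in> C \<Longrightarrow> w \<in> C \<Longrightarrow> z \<preceq>\<^sub>s\<^sub>e w \<Longrightarrow> z = w"
  using saddle_basin_antichain[OF equilibria_mem(2) three(4)] .

text \<open>Moving up means moving down in the south-east order, so the limit is \<open>p1\<close>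
  or \<open>p2\<close>; the antichain property excludes \<open>p2\<close>.\<close>

lemma above_C:
  assumes "(x, y) \<in> C" "y < y'"
  shows "(x, y') \<in> B1"
proof -
  have Q: "(x, y') \<in> quadrant"
    using assms basin_subset_quadrant by (fastforce simp: mem_quadrant_iff)
  have le: "(x, y') \<preceq>\<^sub>s\<^sub>e (x, y)" using assms by (simp add: se_le_def)
  have "(x, y') \<notin> C" using C_antichain[OF _ assms(1) le] assms(2) by auto
  moreover have "(x, y') \<notin> B3" using basin_mono[OF _ assms(1) le] not_ge(3) by blast
  ultimately show ?thesis using basin_cases[OF Q] by blast
qed

lemma below_C:
  assumes "(x, y) \<in> C" "0 \<le> y'" "y' < y"
  shows "(x, y') \<in> B3"
proof -
  have Q: "(x, y') \<in> quadrant"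
    using assms basin_subset_quadrant by (fastforce simp: mem_quadrant_iff)
  have le: "(x, y) \<preceq>\<^sub>s\<^sub>e (x, y')" using assms by (simp add: se_le_def)
  have "(x, y') \<notin> C" using C_antichain[OF assms(1) _ le] assms(3) by auto
  moreover have "(x, y') \<notin> B1" using basin_mono[OF assms(1) _ le] not_ge(1) by blast
  ultimately show ?thesis using basin_cases[OF Q] by blast
qed

lemma B1_near:
  assumes "z \<in> B1"
  obtains \<delta> where "\<delta> > 0" "\<And>w. w \<in> quadrant \<Longrightarrow> dist w z < \<delta> \<Longrightarrow> w \<in> B1"
  using openin_basin[OF three(2)] assms unfolding openin_euclidean_subtopology_iff by meson

lemma B3_near:
  assumes "z \<in> B3"
  obtains \<delta> where "\<delta> > 0" "\<And>w. w \<in> quadrant \<Longrightarrow> dist w z < \<delta> \<Longrightarrow> w \<in> B3"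
  using openin_basin[OF three(3)] assms unfolding openin_euclidean_subtopology_iff by meson

text \<open>For large \<open>y\<close> the image of \<open>(x, y)\<close> lies below
  \<open>p1\<close> in the south-east order, and \<open>B1\<close> is a lower set.\<close>

lemma high_points_in_B1:
  assumes x: "x \<ge> 0"
  obtains y where "y \<ge> 0" "(x, y) \<in> B1"
proof -
  obtain x1 y1 where p1: "p1 = (x1, y1)" by (cases p1)
  note pp = equilibrium_pos[OF equilibria_mem(1), unfolded p1 fst_conv snd_conv]
  \<comment> \<open>After cross-multiplication, the first summand yields the comparison of second
    coordinates with \<open>p1\<close> and the other summand that of first coordinates.\<close>
  define y where "y = y1 * (1 + c2 * x) + x * (1 + c1 * y1) / (c1 * x1)"
  have nn: "y1 * (1 + c2 * x) \<ge> 0" "x * (1 + c1 * y1) / (c1 * x1) \<ge> 0"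
    using pp x c1 c2 by auto
  then have y0: "y \<ge> 0" by (simp add: y_def)
  then have Q: "(x, y) \<in> quadrant" using x by (simp add: mem_quadrant_iff)
  have D: "den1 (x, y) > 0" "den2 (x, y) > 0" "den1 p1 > 0" "den2 p1 > 0"
    using den1_pos den2_pos Q pp(3) by (auto simp: p1)
  have "x * (1 + c1 * y1) = c1 * x1 * (x * (1 + c1 * y1) / (c1 * x1))"
    using pp c1 by simp
  also have "\<dots> \<le> c1 * x1 * y"
    using nn pp c1 by (intro mult_left_mono) (auto simp: y_def)
  finally have "x * den1 p1 \<le> x1 * den1 (x, y)"
    using pp by (simp add: den1_def p1 algebra_simps)
  then have "b1 * (x * den1 p1) \<le> b1 * (x1 * den1 (x, y))" using b1 by simp
  then have f: "fst (T (x, y)) \<le> fst (T p1)"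
    using D by (simp add: fst_T p1[symmetric] frac_le_eq divide_le_eq field_simps) (simp add: p1 algebra_simps)
  have "y1 * (1 + c2 * x) \<le> y * 1" using nn by (simp add: y_def)
  also have "\<dots> \<le> y * (1 + c2 * x1)"
    using y0 pp c2 by (intro mult_left_mono) auto
  finally have "y1 * den2 (x, y) \<le> y * den2 p1"
    using pp by (simp add: den2_def p1 algebra_simps)
  then have "b2 * (y1 * den2 (x, y)) \<le> b2 * (y * den2 p1)" using b2 by simp
  then have g: "snd (T p1) \<le> snd (T (x, y))"
    using D by (simp add: snd_T p1[symmetric] field_simps) (simp add: p1 algebra_simps)
  have "T (x, y) \<preceq>\<^sub>s\<^sub>e p1"
    using f g equilibrium_pos(4)[OF equilibria_mem(1)] by (simp add: se_le_def)
  then have "T (x, y) \<in> B1"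
    using B1_down[OF equilibrium_in_basin[OF equilibria_mem(1)] T_quadrant[OF Q]] by blast
  then have "(x, y) \<in> B1" using orbit_in_basin_iff[OF Q, of 1] by simp
  then show thesis using that y0 by blast
qed

text \<open>The supremum of the heights outside \<open>B1\<close> lies neither in the open set
  \<open>B1\<close>, being approached from outside it, nor in the open set \<open>B3\<close>, since
  everything higher is in \<open>B1\<close>.\<close>

lemma C_over:
  assumes x: "x \<ge> 0" and nB1: "(x, 0) \<notin> B1"
  obtains y where "(x, y) \<in> C"
proof -
  define Y where "Y = {y. 0 \<le> y \<and> (x, y) \<notin> B1}"
  obtain y0 where y0: "y0 \<ge> 0" "(x, y0) \<in> B1" using high_points_in_B1[OF x] .
  have bound: "y \<le> y0" if "y \<in> Y" for y
  proof (rule ccontr)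
    assume "\<not> y \<le> y0"
    then have "(x, y) \<in> B1"
      using that x by (intro B1_down[OF y0(2)]) (auto simp: Y_def mem_quadrant_iff se_le_def)
    then show False using that by (simp add: Y_def)
  qed
  have ne: "0 \<in> Y" using nB1 by (simp add: Y_def)
  have bdd: "bdd_above Y" using bound by (rule bdd_aboveI)
  define y where "y = Sup Y"
  have y: "y \<ge> 0" unfolding y_def using ne bdd by (rule cSup_upper)
  then have Q: "(x, y) \<in> quadrant" using x by (simp add: mem_quadrant_iff)
  have "(x, y) \<notin> B1"
  proof
    assume "(x, y) \<in> B1"
    then obtain \<delta> where \<delta>: "\<delta> > 0" "\<And>w. w \<in> quadrant \<Longrightarrow> dist w (x, y) < \<delta> \<Longrightarrow> w \<in> B1"
      using B1_near by blast
    have "y - \<delta> < Sup Y" using \<delta> by (simp add: y_def)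
    then obtain y' where y': "y' \<in> Y" "y - \<delta> < y'" using less_cSupE ne by blast
    then have "y' \<le> y" unfolding y_def using bdd by (intro cSup_upper)
    then have d: "dist (x, y') (x, y) < \<delta>" using y' by (simp add: dist_Pair_Pair dist_real_def)
    have "(x, y') \<in> B1" using \<delta>(2)[OF _ d] y' x by (simp add: Y_def mem_quadrant_iff)
    then show False using y' by (simp add: Y_def)
  qed
  moreover have "(x, y) \<notin> B3"
  proof
    assume "(x, y) \<in> B3"
    then obtain \<delta> where \<delta>: "\<delta> > 0" "\<And>w. w \<in> quadrant \<Longrightarrow> dist w (x, y) < \<delta> \<Longrightarrow> w \<in> B3"
      using B3_near by blast
    have "dist (x, y + \<delta> / 2) (x, y) < \<delta>" using \<delta> by (simp add: dist_Pair_Pair dist_real_def)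
    then have "(x, y + \<delta> / 2) \<in> B3" using \<delta> x y by (simp add: mem_quadrant_iff)
    then have "y + \<delta> / 2 \<in> Y" using basins_disjoint(2) \<delta> y by (auto simp: Y_def)
    then have "y + \<delta> / 2 \<le> y" unfolding y_def using bdd by (rule cSup_upper)
    then show False using \<delta> by simp
  qed
  ultimately show thesis using that basin_cases[OF Q] by blast
qed

text \<open>The part of the horizontal axis outside \<open>B1\<close> contains the foot of
  \<open>p3\<close>; it is an upper set because \<open>B1\<close> is a lower set, and it contains
  its infimum because \<open>B1\<close> is open.\<close>

lemma axis_interval: obtains a where "a \<ge> 0" "{x. 0 \<le> x \<and> (x, 0) \<notin> B1} = {a..}"
proof -
  define D where "D = {x. 0 \<le> x \<and> (x, 0) \<notin> B1}"
  have "p3 \<preceq>\<^sub>s\<^sub>e (fst p3, 0)" "(fst p3, 0) \<in> quadrant"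
    using equilibrium_pos[OF equilibria_mem(3)] by (auto simp: se_le_def mem_quadrant_iff)
  then have "(fst p3, 0) \<in> B3"
    using B3_up[OF equilibrium_in_basin[OF equilibria_mem(3)]] by blast
  then have ne: "fst p3 \<in> D"
    using basins_disjoint(2) equilibrium_pos[OF equilibria_mem(3)] by (auto simp: D_def)
  have bdd: "bdd_below D" by (rule bdd_belowI[of _ 0]) (simp add: D_def)
  have up: "x' \<in> D" if "x \<in> D" "x \<le> x'" for x x'
    using that B1_down[of "(x', 0)" "(x, 0)"] by (auto simp: D_def se_le_def mem_quadrant_iff)
  define a where "a = Inf D"
  have a0: "a \<ge> 0" unfolding a_def using ne by (intro cInf_greatest) (auto simp: D_def)
  have "a \<in> D"
  proof (rule ccontr)
    assume "a \<notin> D"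
    then have "(a, 0) \<in> B1" using a0 by (simp add: D_def)
    then obtain \<delta> where \<delta>: "\<delta> > 0" "\<And>w. w \<in> quadrant \<Longrightarrow> dist w (a, 0) < \<delta> \<Longrightarrow> w \<in> B1"
      using B1_near by blast
    have "Inf D < a + \<delta>" using \<delta> by (simp add: a_def)
    then obtain x where x: "x \<in> D" "x < a + \<delta>" using cInf_lessD ne by blast
    have "a \<le> x" unfolding a_def using x bdd by (intro cInf_lower)
    then have d: "dist (x, 0::real) (a, 0) < \<delta>" using x by (simp add: dist_Pair_Pair dist_real_def)
    have "(x, 0) \<in> B1" using \<delta>(2)[OF _ d] x by (simp add: D_def mem_quadrant_iff)
    then show False using x by (simp add: D_def)
  qed
  then have "D = {a..}"
    using up bdd by (auto simp: a_def intro: cInf_lower)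
  then show thesis using that a0 by (simp add: D_def)
qed

section \<open>The stable manifold as an increasing separatrix\<close>

lemma stable_manifold_graph: "increasing_graph_between_boundaries C"
proof -
  obtain a where a: "a \<ge> 0" "{x. 0 \<le> x \<and> (x, 0) \<notin> B1} = {a..}" using axis_interval .
  have D: "0 \<le> x \<and> (x, 0) \<notin> B1 \<longleftrightarrow> a \<le> x" for x using a(2) by auto
  have "\<forall>x\<in>{a..}. \<exists>y. (x, y) \<in> C"
    using D C_over by (metis atLeast_iff)
  then obtain f where f: "\<And>x. a \<le> x \<Longrightarrow> (x, f x) \<in> C" by (metis atLeast_iff)
  have nonneg: "0 \<le> x" "0 \<le> f x" if "a \<le> x" for x
    using f[OF that] basin_subset_quadrant by (fastforce simp: mem_quadrant_iff)+
  have graph: "C = (\<lambda>x. (x, f x)) ` {a..}"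
  proof (intro equalityI subsetI)
    fix z assume "z \<in> C"
    then obtain x y where z: "z = (x, y)" "(x, y) \<in> C" by (cases z) auto
    have xy: "0 \<le> x" "0 \<le> y" using z(2) basin_subset_quadrant by (fastforce simp: mem_quadrant_iff)+
    have "(x, 0) \<notin> B1"
      using B1_down[of "(x, 0)" "(x, y)"] basins_disjoint(1) z(2) xy
      by (auto simp: mem_quadrant_iff se_le_def)
    then have ax: "a \<le> x" using D xy by blast
    have "y = f x"
      using above_C[OF f[OF ax], of y] above_C[OF z(2), of "f x"] basins_disjoint(1) z(2) f[OF ax]
      by (cases y "f x" rule: linorder_cases) auto
    then show "z \<in> (\<lambda>x. (x, f x)) ` {a..}" using z ax by auto
  qed (use f in auto)
  have "strict_mono_on {a..} f"
  proof (rule strict_mono_onI)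
    fix x x' assume x: "x \<in> {a..}" "x' \<in> {a..}" "x < x'"
    show "f x < f x'"
    proof (rule ccontr)
      assume "\<not> f x < f x'"
      then have "(x, f x) \<preceq>\<^sub>s\<^sub>e (x', f x')" using x by (simp add: se_le_def)
      then show False using C_antichain[of "(x, f x)" "(x', f x')"] f x by auto
    qed
  qed
  moreover have "continuous_on {a..} f"
    unfolding continuous_on_iff
  proof (intro ballI allI impI)
    fix x \<epsilon> :: real assume x: "x \<in> {a..}" and \<epsilon>: "\<epsilon> > 0"
    then have ax: "a \<le> x" by simp
    \<comment> \<open>A point slightly above the graph has a neighbourhood in the lower set
      \<open>B1\<close>, which keeps nearby values of \<open>f\<close> below its height;
      \<open>B3\<close> gives the lower bound.\<close>
    have "(x, f x + \<epsilon>) \<in> B1" using above_C[OF f[OF ax]] \<epsilon> by simp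
    then obtain \<delta>1 where \<delta>1: "\<delta>1 > 0" "\<And>w. w \<in> quadrant \<Longrightarrow> dist w (x, f x + \<epsilon>) < \<delta>1 \<Longrightarrow> w \<in> B1"
      using B1_near by blast
    have upper: "f x' < f x + \<epsilon>" if "a \<le> x'" "dist x' x < \<delta>1" for x'
    proof (rule ccontr)
      assume *: "\<not> f x' < f x + \<epsilon>"
      have "(x', f x + \<epsilon>) \<in> B1"
        using that \<epsilon> nonneg[OF ax] nonneg[of x'] by (intro \<delta>1(2)) (auto simp: dist_Pair_Pair mem_quadrant_iff)
      then have "(x', f x') \<in> B1"
        using * nonneg[of x'] that by (auto intro: B1_down simp: mem_quadrant_iff se_le_def)
      then show False using f[OF that(1)] basins_disjoint(1) by blast
    qed
    have "\<exists>\<delta>>0. \<forall>x'\<ge>a. dist x' x < \<delta> \<longrightarrow> f x - \<epsilon> < f x'"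
    proof (cases "f x - \<epsilon> \<ge> 0")
      case True
      then have "(x, f x - \<epsilon>) \<in> B3" using below_C[OF f[OF ax]] \<epsilon> by simp
      then obtain \<delta> where \<delta>: "\<delta> > 0" "\<And>w. w \<in> quadrant \<Longrightarrow> dist w (x, f x - \<epsilon>) < \<delta> \<Longrightarrow> w \<in> B3"
        using B3_near by blast
      have "f x - \<epsilon> < f x'" if "a \<le> x'" "dist x' x < \<delta>" for x'
      proof (rule ccontr)
        assume *: "\<not> f x - \<epsilon> < f x'"
        have "(x', f x - \<epsilon>) \<in> B3"
          using that True nonneg[of x'] by (intro \<delta>(2)) (auto simp: dist_Pair_Pair mem_quadrant_iff)
        then have "(x', f x') \<in> B3"
          using * nonneg[of x'] that by (auto intro: B3_up simp: mem_quadrant_iff se_le_def)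
        then show False using f[OF that(1)] basins_disjoint(3) by blast
      qed
      then show ?thesis using \<delta>(1) by blast
    next
      \<comment> \<open>No point of the quadrant lies at a negative height, so here nonnegativity of
        \<open>f\<close> gives the lower bound.\<close>
      case False
      then have "f x - \<epsilon> < f x'" if "a \<le> x'" for x' using nonneg[OF that] by linarith
      then show ?thesis by (intro exI[of _ 1]) auto
    qed
    then obtain \<delta>2 where \<delta>2: "\<delta>2 > 0" "\<And>x'. a \<le> x' \<Longrightarrow> dist x' x < \<delta>2 \<Longrightarrow> f x - \<epsilon> < f x'" by blast
    have "dist (f x') (f x) < \<epsilon>" if "x' \<in> {a..}" "dist x' x < min \<delta>1 \<delta>2" for x'
      using upper[of x'] \<delta>2(2)[of x'] that by (auto simp: dist_real_def abs_less_iff)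
    then show "\<exists>d>0. \<forall>x'\<in>{a..}. dist x' x < d \<longrightarrow> dist (f x') (f x) < \<epsilon>"
      using \<delta>1(1) \<delta>2(1) by (intro exI[of _ "min \<delta>1 \<delta>2"]) auto
  qed
  \<comment> \<open>If the endpoint were an interior point, its foot \<open>(a, 0)\<close> would lie
    in the open set \<open>B3\<close>, and so would points of the axis to the left of it, against
    the choice of \<open>a\<close>.\<close>
  moreover have "a = 0 \<or> f a = 0"
  proof (rule ccontr)
    assume "\<not> ?thesis"
    then have pos: "a > 0" "f a > 0" using a(1) nonneg[of a] by auto
    then have "(a, 0) \<in> B3" using below_C[OF f[of a]] by simp
    then obtain \<delta> where \<delta>: "\<delta> > 0" "\<And>w. w \<in> quadrant \<Longrightarrow> dist w (a, 0) < \<delta> \<Longrightarrow> w \<in> B3"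
      using B3_near by blast
    define x where "x = max 0 (a - \<delta> / 2)"
    have x: "0 \<le> x" "x < a" "dist x a < \<delta>" using pos \<delta>(1) by (auto simp: x_def dist_real_def)
    then have "(x, 0) \<in> B3" by (intro \<delta>(2)) (auto simp: dist_Pair_Pair mem_quadrant_iff)
    then have "a \<le> x" using D[of x] basins_disjoint(2) x by blast
    then show False using x by simp
  qed
  then have "(a, f a) \<in> frontier quadrant"
    using a(1) nonneg[of a] by (auto simp: frontier_quadrant_iff)
  ultimately show ?thesis
    unfolding increasing_graph_between_boundaries_def
    using a(1) graph basin_subset_quadrant by blast
qed

text \<open>Without \<open>C\<close> the quadrant is the disjoint union of two relatively open
  basins, so no connected subset meets both.\<close>

lemma stable_manifold_separates: "separates_in_quadrant C B1 B3"
  unfolding separates_in_quadrant_def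
proof (intro conjI ballI notI)
  show "B1 \<subseteq> quadrant - C" "B3 \<subseteq> quadrant - C"
    using basin_subset_quadrant basins_disjoint by blast+
next
  fix p q assume pq: "p \<in> B1" "q \<in> B3" and "connected_component (quadrant - C) p q"
  then obtain S where S: "connected S" "S \<subseteq> quadrant - C" "p \<in> S" "q \<in> S"
    unfolding connected_component_def by blast
  have SQ: "S \<subseteq> quadrant" using S(2) by blast
  have "openin (top_of_set S) (S \<inter> B1)" "openin (top_of_set S) (S \<inter> B3)"
    using openin_basin[OF three(2)] openin_basin[OF three(3)] SQ
    unfolding openin_euclidean_subtopology_iff by blast+
  moreover have "S \<subseteq> S \<inter> B1 \<union> S \<inter> B3" using S(2) basin_cases by blast
  moreover have "(S \<inter> B1) \<inter> (S \<inter> B3) = {}" using basins_disjoint(2) by blast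
  ultimately show False
    using S(1,3,4) pq unfolding connected_openin by blast
qed

end

theorem theorem3:
  fixes b1 b2 c1 c2 h1 h2 :: real
    and T :: "real \<times> real \<Rightarrow> real \<times> real"
  assumes "b1 > 0" "b2 > 0" "c1 > 0" "c2 > 0" "h1 > 0" "h2 > 0"
    and "T = (\<lambda>(x, y). (b1 * x / (1 + x + c1 * y) + h1, b2 * y / (1 + y + c2 * x) + h2))"
  shows
    "(finite (equilibria T) \<and> 1 \<le> card (equilibria T) \<and> card (equilibria T) \<le> 3 \<and>
      linear_order_on (equilibria T) (relation_of (\<preceq>\<^sub>s\<^sub>e) (equilibria T)))
   \<and>
     (\<forall>p. equilibria T = {p} \<longrightarrow> globally_asymptotically_stable T p)
   \<and>
     (\<forall>p1 p2 p3.
        p1 \<in> equilibria T \<and> p2 \<in> equilibria T \<and> p3 \<in> equilibria T \<and>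
        p1 \<noteq> p2 \<and> p1 \<noteq> p3 \<and> p2 \<noteq> p3 \<and> p1 \<preceq>\<^sub>s\<^sub>e p2 \<and> p2 \<preceq>\<^sub>s\<^sub>e p3 \<longrightarrow>
        locally_asymptotically_stable T p1 \<and> locally_asymptotically_stable T p3 \<and>
        saddle_point T p2 \<and>
        increasing_graph_between_boundaries (global_stable_manifold T p2) \<and>
        separates_in_quadrant (global_stable_manifold T p2) (basin T p1) (basin T p3))
   \<and>
     (card (equilibria T) = 2 \<longrightarrow>
        (\<exists>p q. equilibria T = {p, q} \<and> p \<noteq> q \<and>
           locally_asymptotically_stable T p \<and> nonhyperbolic T q) \<and>
        (\<forall>p q. equilibria T = {p, q} \<and> p \<noteq> q \<and> p \<preceq>\<^sub>s\<^sub>e q \<longrightarrow>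
           Q2 p \<inter> quadrant \<subseteq> basin T p \<and> Q4 q \<inter> quadrant \<subseteq> basin T q))"
proof -
  interpret leslie_gower b1 b2 c1 c2 h1 h2 T
    using assms by unfold_locales
  have bistable: "leslie_gower_bistable b1 b2 c1 c2 h1 h2 T p1 p2 p3"
    if "p1 \<in> equilibria T" "p2 \<in> equilibria T" "p3 \<in> equilibria T"
      "p1 \<noteq> p2" "p1 \<noteq> p3" "p2 \<noteq> p3" "p1 \<preceq>\<^sub>s\<^sub>e p2" "p2 \<preceq>\<^sub>s\<^sub>e p3" for p1 p2 p3
    using that by unfold_locales
  have manifold: "global_stable_manifold T p = basin T p" for p
    by (simp add: global_stable_manifold_def basin_def)
  have "1 \<le> card (equilibria T)"
    using equilibria_exist equilibria_card(1) by (simp add: Suc_le_eq card_gt_0_iff)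
  then have i: "finite (equilibria T) \<and> 1 \<le> card (equilibria T) \<and> card (equilibria T) \<le> 3 \<and>
      linear_order_on (equilibria T) (relation_of (\<preceq>\<^sub>s\<^sub>e) (equilibria T))"
    using equilibria_card equilibria_linear_order by blast
  have ii: "\<forall>p. equilibria T = {p} \<longrightarrow> globally_asymptotically_stable T p"
    using unique_equilibrium_globally_stable by blast
  have iii: "\<forall>p1 p2 p3.
        p1 \<in> equilibria T \<and> p2 \<in> equilibria T \<and> p3 \<in> equilibria T \<and>
        p1 \<noteq> p2 \<and> p1 \<noteq> p3 \<and> p2 \<noteq> p3 \<and> p1 \<preceq>\<^sub>s\<^sub>e p2 \<and> p2 \<preceq>\<^sub>s\<^sub>e p3 \<longrightarrow>
        locally_asymptotically_stable T p1 \<and> locally_asymptotically_stable T p3 \<and>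
        saddle_point T p2 \<and>
        increasing_graph_between_boundaries (global_stable_manifold T p2) \<and>
        separates_in_quadrant (global_stable_manifold T p2) (basin T p1) (basin T p3)"
    unfolding manifold
    using bistable three_equilibria(2-4) saddle_if_det_neg
      leslie_gower_bistable.stable_manifold_graph leslie_gower_bistable.stable_manifold_separates
    by meson
  have iv: "card (equilibria T) = 2 \<longrightarrow>
        (\<exists>p q. equilibria T = {p, q} \<and> p \<noteq> q \<and>
           locally_asymptotically_stable T p \<and> nonhyperbolic T q) \<and>
        (\<forall>p q. equilibria T = {p, q} \<and> p \<noteq> q \<and> p \<preceq>\<^sub>s\<^sub>e q \<longrightarrow>
           Q2 p \<inter> quadrant \<subseteq> basin T p \<and> Q4 q \<inter> quadrant \<subseteq> basin T q)"
    using two_equilibria two_equilibria_basins by blast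
  from i ii iii iv show ?thesis
    by (rule conjI[OF _ conjI[OF _ conjI]])
qed

end
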